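(* Let $P\in\mathbb{C}[x,y]$ have no zeros in $\mathbb{R}\times\mathbb{H}$ and no factors in common with $\bar P$, let $M=\mathrm{Ord}(P(0,y))$, and normalize $P$ so that the coefficient of $y^M$ in $P(0,y)$ is real. Let $(2L_j,q_j)$, $j=1,\dots,M$, be the data from the factorization of $P$ described in the context, and let $A=\tfrac12(P+\bar P)$, $B=\tfrac1{2i}(P-\bar P)$. Then for all but finitely many $t\in\mathbb{R}$ there is a local factorization $$A(x,y)+tB(x,y)=u(x,y;t)\prod_{j=1}^{M}\bigl(y+q_j(x)+x^{2L_j}\psi_j(x;t)\bigr)$$ where, for each fixed such $t$, $u(\cdot,\cdot;t)\in\mathbb{C}\{x,y\}$ is a unit and $\psi_j(\cdot;t)\in\mathbb{R}\{x\}$, and moreover for all $i\neq j$, $$\mathrm{Ord}\bigl(q_j(x)-q_i(x)+x^{2L_j}\psi_j(x;t)-x^{2L_i}\psi_i(x;t)\bigr)=O_{ij}.$$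
   Context: $\mathbb{H}=\{\operatorname{Im}z>0\}$; $\bar P(x,y)=\overline{P(\bar x,\bar y)}$. $\mathbb{C}\{x,y\}$ denotes convergent power series at the origin, $\mathbb{R}\{x\}$ those in $x$ with real coefficients; a unit is a series nonvanishing at the origin; Ord is order of vanishing at $0$. For such $P$ one has (locally) $P=u\prod_{j=1}^M(y+q_j(x)+x^{2L_j}\psi_j(x^{1/k}))$ with $u$ a unit, $k\ge1$, $L_j\in\mathbb{N}$, $q_j\in\mathbb{R}[x]$, $q_j(0)=0$, $\deg q_j<2L_j$, $\psi_j\in\mathbb{C}\{x\}$, $\operatorname{Im}\psi_j(0)>0$; the pairs $(2L_j,q_j)$ are these data. $O_{ij}=\min\{\mathrm{Ord}(q_j-q_i),2L_j,2L_i\}$. *)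

theory Defs
  imports "HOL-Analysis.Analysis" "HOL-Analysis.FPS_Convergence"
begin

text \<open>A polynomial P in C[x,y] is represented as a polynomial in y whose coefficients
are polynomials in x.\<close>

definition eval2 :: "complex poly poly \<Rightarrow> complex \<Rightarrow> complex \<Rightarrow> complex" where
  "eval2 P x y = poly (map_poly (\<lambda>c. poly c x) P) y"

text \<open>Conjugate polynomial: Pbar(x,y) = conj (P(conj x, conj y)).\<close>
definition pbar :: "complex poly poly \<Rightarrow> complex poly poly" where
  "pbar P = map_poly (map_poly cnj) P"

definition at_x0 :: "complex poly poly \<Rightarrow> complex poly" where
  "at_x0 P = map_poly (\<lambda>c. poly c 0) P"

definition conv_ps2 :: "(nat \<Rightarrow> nat \<Rightarrow> complex) \<Rightarrow> bool" where
  "conv_ps2 c \<longleftrightarrow> (\<exists>\<rho>>0. (\<lambda>(m,n). norm (c m n) * \<rho> ^ (m + n)) summable_on UNIV)"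

definition eval_ps2 :: "(nat \<Rightarrow> nat \<Rightarrow> complex) \<Rightarrow> complex \<Rightarrow> complex \<Rightarrow> complex" where
  "eval_ps2 c x y = (\<Sum>\<^sub>\<infinity>(m,n)\<in>UNIV. c m n * x ^ m * y ^ n)"

definition unit_ps2 :: "(nat \<Rightarrow> nat \<Rightarrow> complex) \<Rightarrow> bool" where
  "unit_ps2 c \<longleftrightarrow> conv_ps2 c \<and> c 0 0 \<noteq> 0"

definition Ord :: "'a::zero fps \<Rightarrow> enat" where
  "Ord f = (if f = 0 then \<infinity> else enat (subdegree f))"

definition cfps :: "real fps \<Rightarrow> complex fps" where
  "cfps f = Abs_fps (\<lambda>n. complex_of_real (fps_nth f n))"

definition Oij :: "(nat \<Rightarrow> real poly) \<Rightarrow> (nat \<Rightarrow> nat) \<Rightarrow> nat \<Rightarrow> nat \<Rightarrow> enat" where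
  "Oij q L i j = min (Ord (fps_of_poly (q j - q i))) (min (enat (2 * L j)) (enat (2 * L i)))"

end

theory Submission
  imports Defs "HOL-Complex_Analysis.Laurent_Convergence"
    "HOL-Computational_Algebra.Fundamental_Theorem_Algebra"
begin

text \<open>
  Write \<open>F\<^sub>t = A + t B = ((1 - i t) P + (1 + i t) P\<^sup>*) / 2\<close> with \<open>*\<close> conjugating coefficients. Fix one of the data \<open>(2L, q)\<close> and blow up by
  \<open>y = -q(x) + x\<^sup>2\<^sup>L w\<close>. For each factor of \<open>P\<close>, dividing by \<open>x\<close> to the power \<open>O\<^sub>i\<^sub>j\<close> and letting \<open>x\<close> decrease
  to \<open>0\<close> gives a limit in \<open>w\<close>; hence \<open>F\<^sub>t(x, -q + x\<^sup>2\<^sup>L w)\<close> is \<open>x\<^sup>N\<close> times a real polynomial in \<open>(x, w)\<close> whose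
  restriction to \<open>x = 0\<close> is \<open>R h\<^sub>t\<close>. Here \<open>R\<close> is a real product of linear forms, one for each datum that agrees
  with \<open>q\<close> to order \<open>2L\<close> and has a larger \<open>L\<close>, and \<open>h\<^sub>t = ((1 - i t) g + (1 + i t) g\<^sup>*) / 2\<close>, where \<open>g\<close> has degree
  equal to the multiplicity of the datum \<open>(2L, q)\<close> and all its zeros in the lower half plane.
  By Hermite--Biehler the zeros of \<open>h\<^sub>t\<close> are real and simple, and for generic \<open>t\<close> there are \<open>deg g\<close> of them and they avoid those of \<open>R\<close>, so the
  implicit function theorem gives one real analytic branch through each of them. Altogether these are \<open>M\<close>
  distinct roots of \<open>F\<^sub>t\<close> in the ring of convergent power series in \<open>x\<close>; since \<open>F\<^sub>t(0, y)\<close> vanishes to order exactly \<open>M\<close>,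
  dividing \<open>F\<^sub>t\<close> by the corresponding linear factors leaves a unit.
\<close>

subsection \<open>Bivariate polynomials\<close>

lemma eval2_0 [simp]: "eval2 0 x y = 0"
  by (simp add: eval2_def)

lemma eval2_pCons [simp]: "eval2 (pCons a p) x y = poly a x + y * eval2 p x y"
  by (simp add: eval2_def map_poly_pCons)

text \<open>Evaluation at the constant polynomial \<open>[:y:]\<close> and then at \<open>x\<close>
  is a composite of two ring homomorphisms, so compatibility with sums and scalar multiples comes
  for free.\<close>

lemma eval2_conv_poly: "eval2 p x y = poly (poly p [:y:]) x"
  by (induction p) (simp_all add: mult.commute)

lemma eval2_add: "eval2 (p + q) x y = eval2 p x y + eval2 q x y"
  by (simp add: eval2_conv_poly)

lemma eval2_smult: "eval2 (smult c p) x y = poly c x * eval2 p x y"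
  by (simp add: eval2_conv_poly)

lemma eval2_pcompose: "eval2 (pcompose p [:a, b:]) x y = eval2 p x (poly a x + y * poly b x)"
  by (induction p) (simp_all add: pcompose_pCons eval2_conv_poly algebra_simps)

lemma eval2_at_0: "eval2 p 0 y = poly (at_x0 p) y"
  by (simp add: eval2_def at_x0_def)

lemma poly_map_poly_cnj: "poly (map_poly cnj a) x = cnj (poly a (cnj x))"
  by (induction a) (simp_all add: map_poly_pCons)

lemma eval2_pbar: "eval2 (pbar p) x y = cnj (eval2 p (cnj x) (cnj y))"
proof (induction p)
  case (pCons a p)
  then show ?case
    unfolding pbar_def by (simp add: map_poly_pCons poly_map_poly_cnj)
qed (simp add: pbar_def)

lemma eval2_eqI:
  assumes "\<And>x y. eval2 p x y = eval2 q x y"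
  shows "p = q"
proof (rule poly_eqI)
  fix n
  have "poly (coeff p n) x = poly (coeff q n) x" for x
  proof -
    have "poly (map_poly (\<lambda>c. poly c x) p) = poly (map_poly (\<lambda>c. poly c x) q)"
      using assms by (auto simp: eval2_def)
    then have "coeff (map_poly (\<lambda>c. poly c x) p) n = coeff (map_poly (\<lambda>c. poly c x) q) n"
      by (simp add: poly_eq_poly_eq_iff)
    then show ?thesis by (simp add: coeff_map_poly)
  qed
  then show "coeff p n = coeff q n"
    by (metis poly_eq_poly_eq_iff ext)
qed

lemma continuous_eval2 [continuous_intros]:
  assumes "continuous_on S f" "continuous_on S g"
  shows "continuous_on S (\<lambda>z. eval2 p (f z) (g z))"
  using assms by (induction p) (auto intro!: continuous_intros)

lemma tendsto_eval2 [tendsto_intros]: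
  assumes "(f \<longlongrightarrow> a) F" "(g \<longlongrightarrow> b) F"
  shows "((\<lambda>z. eval2 p (f z) (g z)) \<longlongrightarrow> eval2 p a b) F"
  using assms by (induction p) (auto intro!: tendsto_intros)

text \<open>Limits along positive real \<open>x\<close> already force divisibility: multiplying the
  quotient by the vanishing power of \<open>x\<close> shows \<open>Q(0, w) = 0\<close> for every
  \<open>w\<close>, so \<open>x\<close> divides every coefficient, and one factor is split off per
  induction step. Hence the fractional powers of \<open>x\<close> need to be controlled only on the
  positive axis.\<close>

lemma eval2_divide_power_x:
  assumes "\<And>w. ((\<lambda>x. eval2 Q (of_real x) w / of_real x ^ N) \<longlongrightarrow> H w) (at_right 0)"
  shows "\<exists>Q'. Q = smult (monom 1 N) Q' \<and> (\<forall>w. eval2 Q' 0 w = H w)"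
  using assms
proof (induction N arbitrary: Q)
  case 0
  have "eval2 Q 0 w = H w" for w
  proof (rule tendsto_unique)
    show "((\<lambda>x. eval2 Q (of_real x) w) \<longlongrightarrow> H w) (at_right 0)"
      using 0 by simp
    show "((\<lambda>x. eval2 Q (of_real x) w) \<longlongrightarrow> eval2 Q 0 w) (at_right 0)"
      by (intro tendsto_eval2 tendsto_eq_intros) auto
  qed auto
  then show ?case by (intro exI[of _ Q]) simp
next
  case (Suc N)
  have "eval2 Q 0 w = 0" for w
  proof (rule tendsto_unique)
    show "((\<lambda>x. eval2 Q (of_real x) w) \<longlongrightarrow> eval2 Q 0 w) (at_right 0)"
      by (intro tendsto_eval2 tendsto_eq_intros) auto
    have "((\<lambda>x. of_real x ^ Suc N * (eval2 Q (of_real x) w / of_real x ^ Suc N))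
            \<longlongrightarrow> of_real 0 ^ Suc N * H w) (at_right 0)"
      by (intro tendsto_intros Suc.prems)
    moreover have "\<forall>\<^sub>F x in at_right (0::real).
        of_real x ^ Suc N * (eval2 Q (of_real x) w / of_real x ^ Suc N) = eval2 Q (of_real x) w"
      using eventually_at_right_less[of 0] by eventually_elim auto
    ultimately show "((\<lambda>x. eval2 Q (of_real x) w) \<longlongrightarrow> 0) (at_right 0)"
      using tendsto_cong by fastforce
  qed auto
  then have "poly (at_x0 Q) = poly 0"
    by (auto simp: eval2_at_0)
  then have "at_x0 Q = 0"
    by (simp only: poly_eq_poly_eq_iff)
  then have dvd: "[:0, 1:] dvd coeff Q n" for n
    by (metis at_x0_def coeff_0 coeff_map_poly poly_0 dvd_iff_poly_eq_0 neg_0_equal_iff_equal)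
  define Q1 where "Q1 = map_poly (\<lambda>c. c div [:0, 1:]) Q"
  have Q: "Q = smult [:0, 1:] Q1"
    by (rule poly_eqI) (simp add: Q1_def coeff_map_poly dvd_mult_div_cancel[OF dvd] del: mult_pCons_left)
  have "((\<lambda>x. eval2 Q1 (of_real x) w / of_real x ^ N) \<longlongrightarrow> H w) (at_right 0)" for w
  proof (rule Lim_transform_eventually[OF Suc.prems])
    show "\<forall>\<^sub>F x in at_right 0. eval2 Q (of_real x) w / of_real x ^ Suc N
            = eval2 Q1 (of_real x) w / of_real x ^ N"
      using eventually_at_right_less[of 0] by eventually_elim (auto simp: Q eval2_smult)
  qed
  from Suc.IH[OF this] obtain Q' where "Q1 = smult (monom 1 N) Q'" "\<forall>w. eval2 Q' 0 w = H w"
    by blast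
  then show ?case
    by (intro exI[of _ Q']) (simp add: Q monom_Suc)
qed

text \<open>A difference quotient that is jointly continuous across the diagonal, built by Horner
  recursion. It and its counterpart in \<open>x\<close> replace partial derivatives in
  \<open>implicit_function_polynomial\<close>.\<close>

lemma eval2_diff_snd:
  "\<exists>D. continuous_on UNIV (\<lambda>(x, w, w'). D x w w')
     \<and> (\<forall>x w w'. eval2 p x w - eval2 p x w' = (w - w') * D x w w')"
proof (induction p)
  case 0
  then show ?case by (intro exI[of _ "\<lambda>_ _ _. 0"]) auto
next
  case (pCons a p)
  then obtain D where D: "continuous_on UNIV (\<lambda>(x, w, w'). D x w w')"
    "\<And>x w w'. eval2 p x w - eval2 p x w' = (w - w') * D x w w'"
    by blast
  have "continuous_on UNIV (\<lambda>(x, w, w'). eval2 p x w + w' * D x w w')"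
    using D(1) by (auto simp: case_prod_unfold intro!: continuous_intros)
  moreover have "eval2 (pCons a p) x w - eval2 (pCons a p) x w'
      = (w - w') * (eval2 p x w + w' * D x w w')" for x w w'
    using D(2)[of x w w'] by (simp, algebra)
  ultimately show ?case
    by (intro exI[of _ "\<lambda>x w w'. eval2 p x w + w' * D x w w'"]) auto
qed

lemma eval2_diff_fst:
  "\<exists>E. continuous_on UNIV (\<lambda>(x, x', w). E x x' w)
     \<and> (\<forall>x x' w. eval2 p x w - eval2 p x' w = (x - x') * E x x' w)"
proof (induction p)
  case 0
  then show ?case by (intro exI[of _ "\<lambda>_ _ _. 0"]) auto
next
  case (pCons a p)
  then obtain E where E: "continuous_on UNIV (\<lambda>(x, x', w). E x x' w)"
    "\<And>x x' w. eval2 p x w - eval2 p x' w = (x - x') * E x x' w"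
    by blast
  have "\<exists>e. continuous_on UNIV (\<lambda>(x, x'). e x x') \<and> (\<forall>x x'. poly a x - poly a x' = (x - x') * e x x')"
  proof (induction a)
    case 0
    then show ?case by (intro exI[of _ "\<lambda>_ _. 0"]) auto
  next
    case (pCons c a)
    then obtain e where e: "continuous_on UNIV (\<lambda>(x, x'). e x x')"
       "\<And>x x'. poly a x - poly a x' = (x - x') * e x x'"
      by blast
    have "continuous_on UNIV (\<lambda>(x, x'). poly a x + x' * e x x')"
      using e(1) by (auto simp: case_prod_unfold intro!: continuous_intros)
    moreover have "poly (pCons c a) x - poly (pCons c a) x' = (x - x') * (poly a x + x' * e x x')" for x x'
      using e(2)[of x x'] by (simp, algebra)
    ultimately show ?case
      by (intro exI[of _ "\<lambda>x x'. poly a x + x' * e x x'"]) auto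
  qed
  then obtain e where e: "continuous_on UNIV (\<lambda>(x, x'). e x x')"
    "\<And>x x'. poly a x - poly a x' = (x - x') * e x x'"
    by blast
  have "continuous_on UNIV (\<lambda>(x, x', w::complex). e x x')"
    using continuous_on_compose2[OF e(1), of UNIV "\<lambda>z. (fst z, fst (snd z))",
      OF continuous_on_Pair[OF continuous_on_fst continuous_on_fst[OF continuous_on_snd]]]
    by (simp add: case_prod_unfold)
  then have "continuous_on UNIV (\<lambda>(x, x', w). e x x' + w * E x x' w)"
    using E(1) by (auto simp: case_prod_unfold intro!: continuous_intros)
  moreover have "eval2 (pCons a p) x w - eval2 (pCons a p) x' w
      = (x - x') * (e x x' + w * E x x' w)" for x x' w
    using E(2)[of x w x'] e(2)[of x x'] by (simp, algebra)
  ultimately show ?case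
    by (intro exI[of _ "\<lambda>x x' w. e x x' + w * E x x' w"]) auto
qed

subsection \<open>Analytic branches through a simple root\<close>

text \<open>Newton's map with frozen slope, \<open>w - eval2 Q x w / c\<close> with \<open>c\<close>
  the derivative at \<open>w0\<close>, contracts a small closed disc for all small \<open>x\<close>;
  its fixed point is the branch. The quotients \<open>D\<close> and \<open>E\<close> then give
  continuity and complex differentiability.\<close>

lemma implicit_function_polynomial:
  assumes root: "eval2 Q 0 w0 = 0" and simple: "poly (pderiv (at_x0 Q)) w0 \<noteq> 0"
  shows "\<exists>W \<delta>. 0 < \<delta> \<and> W holomorphic_on ball 0 \<delta> \<and> W 0 = w0 \<and> (\<forall>x\<in>ball 0 \<delta>. eval2 Q x (W x) = 0)"
proof -
  obtain D where D: "continuous_on UNIV (\<lambda>(x, w, w'). D x w w')"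
    "\<And>x w w'. eval2 Q x w - eval2 Q x w' = (w - w') * D x w w'"
    using eval2_diff_snd by blast
  obtain E where E: "continuous_on UNIV (\<lambda>(x, x', w). E x x' w)"
    "\<And>x x' w. eval2 Q x w - eval2 Q x' w = (x - x') * E x x' w"
    using eval2_diff_fst by blast
  have D_tendsto: "((\<lambda>z. D (f z) (g z) (h z)) \<longlongrightarrow> D a b c) F"
    if "(f \<longlongrightarrow> a) F" "(g \<longlongrightarrow> b) F" "(h \<longlongrightarrow> c) F" for f g h a b c and F :: "complex filter"
    using continuous_on_tendsto_compose[OF D(1) tendsto_Pair[OF that(1) tendsto_Pair[OF that(2,3)]]]
    by simp
  have E_tendsto: "((\<lambda>z. E (f z) (g z) (h z)) \<longlongrightarrow> E a b c) F"
    if "(f \<longlongrightarrow> a) F" "(g \<longlongrightarrow> b) F" "(h \<longlongrightarrow> c) F" for f g h a b c and F :: "complex filter"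
    using continuous_on_tendsto_compose[OF E(1) tendsto_Pair[OF that(1) tendsto_Pair[OF that(2,3)]]]
    by simp
  define c where "c = D 0 w0 w0"
  have "c = poly (pderiv (at_x0 Q)) w0"
  proof (rule DERIV_unique)
    show "((\<lambda>w. eval2 Q 0 w) has_field_derivative poly (pderiv (at_x0 Q)) w0) (at w0)"
      unfolding eval2_at_0 by (rule poly_DERIV)
    have "((\<lambda>w. D 0 w w0) \<longlongrightarrow> c) (at w0)"
      unfolding c_def by (intro D_tendsto tendsto_intros)
    moreover have "\<forall>\<^sub>F w in at w0. D 0 w w0 = (eval2 Q 0 w - eval2 Q 0 w0) / (w - w0)"
      by (auto simp: D(2) eventually_at_filter)
    ultimately show "((\<lambda>w. eval2 Q 0 w) has_field_derivative c) (at w0)"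
      unfolding has_field_derivative_iff by (rule Lim_transform_eventually)
  qed
  with simple have c: "c \<noteq> 0" by simp

  have "isCont (\<lambda>(x, w, w'). D x w w') (0, w0, w0)"
    using D(1) by (simp add: continuous_on_eq_continuous_at)
  then have "\<exists>d>0. \<forall>z. dist z (0, w0, w0) < d \<longrightarrow> dist (case z of (x, w, w') \<Rightarrow> D x w w') c < norm c / 2"
    using c by (auto simp: continuous_at_eps_delta c_def dest!: spec[of _ "norm c / 2"])
  then obtain d where d: "d > 0"
    "\<And>x w w'. dist (x, w, w') (0, w0, w0) < d \<Longrightarrow> dist (D x w w') c < norm c / 2"
    by fast
  \<comment> \<open>A quarter suffices: each of the three coordinates moves by at most
    \<open>\<epsilon>\<close>, hence the triple by less than \<open>d\<close>.\<close>
  define \<epsilon> where "\<epsilon> = d / 4"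
  have \<epsilon>: "\<epsilon> > 0" using d by (simp add: \<epsilon>_def)
  have D_near: "dist (D x w w') c < norm c / 2"
    if "norm x < \<epsilon>" "dist w w0 \<le> \<epsilon>" "dist w' w0 \<le> \<epsilon>" for x w w'
  proof (rule d(2))
    have "dist (x, w, w') (0, w0, w0) \<le> dist x 0 + dist (w, w') (w0, w0)"
      unfolding dist_Pair_Pair[of x] by (rule sqrt_sum_squares_le_sum) auto
    also have "dist (w, w') (w0, w0) \<le> dist w w0 + dist w' w0"
      by (simp add: dist_Pair_Pair sqrt_sum_squares_le_sum)
    finally show "dist (x, w, w') (0, w0, w0) < d"
      using that \<epsilon> by (simp add: \<epsilon>_def)
  qed
  \<comment> \<open>The tolerance \<open>norm c * \<epsilon> / 2\<close> makes the map move the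
    centre \<open>w0\<close> by at most \<open>\<epsilon> / 2\<close>; the contraction factor 1/2
    accounts for the other half of the radius.\<close>
  have "isCont (\<lambda>x. eval2 Q x w0) 0"
    unfolding isCont_def by (intro tendsto_intros)
  then obtain \<delta>' where \<delta>': "\<delta>' > 0" "\<And>x. norm x < \<delta>' \<Longrightarrow> norm (eval2 Q x w0) < norm c * \<epsilon> / 2"
    using root c \<epsilon> unfolding continuous_at_eps_delta
    by (auto dest!: spec[of _ "norm c * \<epsilon> / 2"])
  define \<delta> where "\<delta> = min \<delta>' \<epsilon>"
  have \<delta>: "\<delta> > 0" using \<delta>' \<epsilon> by (simp add: \<delta>_def)

  have "\<exists>!w. w \<in> cball w0 \<epsilon> \<and> w - eval2 Q x w / c = w" if x: "norm x < \<delta>" for x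
  proof (rule Banach_fix)
    have lip: "dist (w - eval2 Q x w / c) (w' - eval2 Q x w' / c) \<le> 1/2 * dist w w'"
      if "dist w w0 \<le> \<epsilon>" "dist w' w0 \<le> \<epsilon>" for w w'
    proof -
      have "w - eval2 Q x w / c - (w' - eval2 Q x w' / c) = (w - w') * ((c - D x w w') / c)"
        using D(2)[of x w w'] c by (simp add: field_simps) algebra
      moreover have "norm ((c - D x w w') / c) \<le> 1/2"
        using D_near[of x w w'] x that c by (simp add: \<delta>_def norm_divide field_simps dist_norm norm_minus_commute)
      ultimately show ?thesis
        using mult_left_mono[of "norm ((c - D x w w') / c)" "1/2" "norm (w - w')"]
        by (simp add: dist_norm norm_mult norm_divide)
    qed
    show "(\<lambda>w. w - eval2 Q x w / c) ` cball w0 \<epsilon> \<subseteq> cball w0 \<epsilon>"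
    proof safe
      fix w assume w: "w \<in> cball w0 \<epsilon>"
      have "dist (w - eval2 Q x w / c) w0
          \<le> dist (w - eval2 Q x w / c) (w0 - eval2 Q x w0 / c) + dist (w0 - eval2 Q x w0 / c) w0"
        by (rule dist_triangle)
      also have "\<dots> \<le> 1/2 * \<epsilon> + 1/2 * \<epsilon>"
      proof (rule add_mono)
        show "dist (w - eval2 Q x w / c) (w0 - eval2 Q x w0 / c) \<le> 1/2 * \<epsilon>"
          using lip[of w w0] w \<epsilon> by (auto simp: dist_commute)
        show "dist (w0 - eval2 Q x w0 / c) w0 \<le> 1/2 * \<epsilon>"
          using \<delta>'(2)[of x] x c by (simp add: \<delta>_def dist_norm norm_divide field_simps)
      qed
      finally show "w - eval2 Q x w / c \<in> cball w0 \<epsilon>" by (simp add: dist_commute)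
    qed
    show "dist (w - eval2 Q x w / c) (w' - eval2 Q x w' / c) \<le> 1/2 * dist w w'"
      if "w \<in> cball w0 \<epsilon>" "w' \<in> cball w0 \<epsilon>" for w w'
      using lip that by (simp add: dist_commute)
  qed (use \<epsilon> in \<open>auto simp: complete_eq_closed\<close>)
  then have ex1: "\<exists>!w. dist w w0 \<le> \<epsilon> \<and> eval2 Q x w = 0" if "norm x < \<delta>" for x
    using c that by (simp add: dist_commute)
  define W where "W = (\<lambda>x. THE w. dist w w0 \<le> \<epsilon> \<and> eval2 Q x w = 0)"
  have W: "dist (W x) w0 \<le> \<epsilon>" "eval2 Q x (W x) = 0" if "norm x < \<delta>" for x
    using theI'[OF ex1[OF that]] by (simp_all add: W_def)
  have W0: "W 0 = w0"
    unfolding W_def using \<delta> \<epsilon> root by (intro the1_equality ex1) auto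
  have D_ge: "norm (D x (W x) (W x')) \<ge> norm c / 2" if "norm x < \<delta>" "norm x' < \<delta>" for x x'
    using D_near[of x "W x" "W x'"] W(1) that norm_triangle_ineq2[of c "D x (W x) (W x')"]
    by (simp add: \<delta>_def dist_norm norm_minus_commute)
  \<comment> \<open>Both points of the graph are zeros of \<open>Q\<close>, so the change of
    \<open>Q\<close> in \<open>w\<close> and its change in \<open>x\<close> cancel.\<close>
  have diff: "(W x - W x') * D x (W x) (W x') = - (x - x') * E x x' (W x')"
    if "norm x < \<delta>" "norm x' < \<delta>" for x x'
    using D(2)[of x "W x" "W x'"] E(2)[of x "W x'" x'] W(2)[of x] W(2)[of x'] that by (simp, algebra)
  have "(W has_field_derivative - E a a (W a) / D a (W a) (W a)) (at a)" if a: "norm a < \<delta>" for a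
  proof -
    have near: "\<forall>\<^sub>F x in at a. norm x < \<delta> \<and> x \<noteq> a"
    proof -
      have "\<forall>\<^sub>F x in nhds a. x \<in> ball 0 \<delta>"
        using a by (intro eventually_nhds_in_open) auto
      then show ?thesis by (auto simp: eventually_at_filter elim: eventually_mono)
    qed
    \<comment> \<open>Continuity has to come first, because the difference quotient of
      \<open>W\<close> involves \<open>D\<close> at \<open>W x\<close>.\<close>
    have "((\<lambda>x. W x - W a) \<longlongrightarrow> 0) (at a)"
    proof (rule Lim_null_comparison)
      show "\<forall>\<^sub>F x in at a. norm (W x - W a) \<le> norm (x - a) * norm (E x a (W a)) / (norm c / 2)"
        using near
      proof eventually_elim
        case (elim x)
        have "norm (W x - W a) * (norm c / 2) \<le> norm (W x - W a) * norm (D x (W x) (W a))"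
          using D_ge[of x a] elim a by (intro mult_left_mono) auto
        also have "\<dots> = norm (x - a) * norm (E x a (W a))"
          using diff[of x a] elim a by (metis norm_mult norm_minus_cancel)
        finally show ?case using c by (simp add: field_simps)
      qed
      have "((\<lambda>x. norm (x - a) * norm (E x a (W a)) / (norm c / 2))
              \<longlongrightarrow> norm (a - a) * norm (E a a (W a)) / (norm c / 2)) (at a)"
        using c by (intro tendsto_intros E_tendsto) auto
      then show "((\<lambda>x. norm (x - a) * norm (E x a (W a)) / (norm c / 2)) \<longlongrightarrow> 0) (at a)"
        by simp
    qed
    then have W_lim: "(W \<longlongrightarrow> W a) (at a)"
      by (simp add: LIM_zero_iff)
    have "((\<lambda>x. - E x a (W a) / D x (W x) (W a)) \<longlongrightarrow> - E a a (W a) / D a (W a) (W a)) (at a)"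
      using D_ge[OF a a] c by (intro tendsto_intros E_tendsto D_tendsto W_lim) auto
    moreover have "\<forall>\<^sub>F x in at a. - E x a (W a) / D x (W x) (W a) = (W x - W a) / (x - a)"
      using near
    proof eventually_elim
      case (elim x)
      have "D x (W x) (W a) \<noteq> 0"
        using D_ge[of x a] elim a c by auto
      then show ?case
        using diff[of x a] elim a by (simp add: field_simps)
    qed
    ultimately show ?thesis
      unfolding has_field_derivative_iff by (rule Lim_transform_eventually)
  qed
  then have "W holomorphic_on ball 0 \<delta>"
    unfolding holomorphic_on_open[OF open_ball] by (metis mem_ball_0)
  with W0 W(2) \<delta> show ?thesis
    by (intro exI[of _ W] exI[of _ \<delta>]) auto
qed

lemma has_fps_expansion_of_poly: "poly a has_fps_expansion fps_of_poly a" for a :: "complex poly"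
  by (auto simp: has_fps_expansion_def)

lemma has_fps_expansion_eval2:
  assumes "W has_fps_expansion f"
  shows "(\<lambda>x. eval2 Q x (W x)) has_fps_expansion poly (map_poly fps_of_poly Q) f"
proof (induction Q)
  case (pCons a Q)
  then show ?case
    using assms by (auto simp: map_poly_pCons intro!: fps_expansion_intros has_fps_expansion_of_poly)
qed simp

lemma implicit_function_fps:
  assumes "eval2 Q 0 w0 = 0" and "poly (pderiv (at_x0 Q)) w0 \<noteq> 0"
  shows "\<exists>f. fps_conv_radius f > 0 \<and> fps_nth f 0 = w0 \<and> poly (map_poly fps_of_poly Q) f = 0"
proof -
  obtain W \<delta> where W: "0 < \<delta>" "W holomorphic_on ball 0 \<delta>" "W 0 = w0" "\<forall>x\<in>ball 0 \<delta>. eval2 Q x (W x) = 0"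
    using implicit_function_polynomial[OF assms] by blast
  define f where "f = fps_expansion W 0"
  have f: "W has_fps_expansion f"
    unfolding f_def using W by (intro has_fps_expansion_fps_expansion[of "ball 0 \<delta>"]) auto
  have "\<forall>\<^sub>F x in nhds 0. x \<in> ball 0 \<delta>"
    using W(1) by (intro eventually_nhds_in_open) auto
  then have "(\<lambda>x. eval2 Q x (W x)) has_fps_expansion 0"
    using W(4) by (auto simp: has_fps_expansion_0_iff elim: eventually_mono)
  then have "poly (map_poly fps_of_poly Q) f = 0"
    using fps_expansion_unique_complex has_fps_expansion_eval2[OF f] by blast
  moreover have "fps_nth f 0 = w0"
    using has_fps_expansion_imp_0_eq_fps_nth_0[OF f] W(3) by simp
  ultimately show ?thesis
    using f by (auto simp: has_fps_expansion_def)
qed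

text \<open>Divide by the linear factor of \<open>f\<close>. A second root \<open>g\<close> would be
  a root of the cofactor, and at \<open>x = 0\<close> the cofactor takes the value of the derivative
  at the common constant term.\<close>

lemma fps_root_unique:
  assumes "poly (map_poly fps_of_poly Q) f = 0" "poly (map_poly fps_of_poly Q) g = 0"
    and "fps_nth f 0 = fps_nth g 0" and simple: "poly (pderiv (at_x0 Q)) (fps_nth f 0) \<noteq> 0"
  shows "f = (g :: complex fps)"
proof (rule ccontr)
  assume "f \<noteq> g"
  define Qf where "Qf = map_poly fps_of_poly Q"
  define S where "S = synthetic_div Qf f"
  have Qf: "Qf = [:- f, 1:] * S"
    using synthetic_div_correct'[of f Qf] assms(1) by (simp add: S_def Qf_def)
  have "poly Qf g = (g - f) * poly S g"
    unfolding Qf by (simp add: algebra_simps)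
  with assms(2) \<open>f \<noteq> g\<close> have Sg: "poly S g = 0"
    by (simp add: Qf_def)
  define S0 where "S0 = map_poly (\<lambda>h. fps_nth h 0) S"
  have nth0: "fps_nth (poly T h) 0 = poly (map_poly (\<lambda>h. fps_nth h 0) T) (fps_nth h 0)" for T and h :: "complex fps"
    by (induction T) (auto simp: map_poly_pCons)
  have "at_x0 Q = map_poly (\<lambda>h. fps_nth h 0) Qf"
    by (rule poly_eqI) (simp add: at_x0_def Qf_def coeff_map_poly poly_0_coeff_0)
  also have "\<dots> = [:- fps_nth f 0, 1:] * S0"
    by (rule poly_eqI) (auto simp: Qf S0_def coeff_map_poly coeff_pCons split: nat.splits)
  finally have "poly (pderiv (at_x0 Q)) (fps_nth f 0) = poly S0 (fps_nth f 0)"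
    by (simp only: pderiv_mult) (simp add: pderiv_pCons)
  also have "\<dots> = 0"
    using nth0[of S g] Sg assms(3) by (simp add: S0_def)
  finally show False using simple by simp
qed

lemma cfps_nth [simp]: "fps_nth (cfps f) n = of_real (fps_nth f n)"
  by (simp add: cfps_def)

lemma fps_conv_radius_cfps [simp]: "fps_conv_radius (cfps f) = fps_conv_radius f"
  by (simp add: fps_conv_radius_def conv_radius_def)

text \<open>Conjugating the coefficients of the branch gives another root of the real polynomial
  \<open>Q\<close> with the same real constant term; by uniqueness the branch is its own
  conjugate.\<close>

lemma implicit_function_real_fps:
  assumes real: "pbar Q = Q" and root: "eval2 Q 0 (of_real s) = 0"
    and simple: "poly (pderiv (at_x0 Q)) (of_real s) \<noteq> 0"
  shows "\<exists>f. fps_conv_radius f > 0 \<and> fps_nth f 0 = s \<and> poly (map_poly fps_of_poly Q) (cfps f) = 0"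
proof -
  obtain f where f: "fps_conv_radius f > 0" "fps_nth f 0 = of_real s" "poly (map_poly fps_of_poly Q) f = 0"
    using implicit_function_fps[OF root simple] by blast
  define cj where "cj = (\<lambda>h. Abs_fps (\<lambda>n. cnj (fps_nth h n)))"
  have cj: "cj (a + b) = cj a + cj b" "cj (a * b) = cj a * cj b" "cj 0 = 0" for a b
    by (simp_all add: cj_def fps_eq_iff fps_mult_nth)
  have "cj (poly (map_poly fps_of_poly T) f) = poly (map_poly fps_of_poly (pbar T)) (cj f)" for T
  proof (induction T)
    case (pCons a T)
    moreover have "cj (fps_of_poly a) = fps_of_poly (map_poly cnj a)"
      by (simp add: cj_def fps_eq_iff coeff_map_poly)
    ultimately show ?case
      by (simp add: map_poly_pCons cj pbar_def)
  qed (simp add: cj pbar_def)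
  from this[of Q] have "poly (map_poly fps_of_poly Q) (cj f) = 0"
    using f(3) real by (simp add: cj)
  then have "cj f = f"
  proof (rule fps_root_unique[OF _ f(3)])
    show "fps_nth (cj f) 0 = fps_nth f 0"
      by (simp add: cj_def f(2))
    then show "poly (pderiv (at_x0 Q)) (fps_nth (cj f) 0) \<noteq> 0"
      using simple f(2) by simp
  qed
  then have nth: "fps_nth f n = of_real (Re (fps_nth f n))" for n
  proof -
    have "cnj (fps_nth f n) = fps_nth f n"
      using arg_cong[OF \<open>cj f = f\<close>, of "\<lambda>h. fps_nth h n"] by (simp add: cj_def)
    then show ?thesis by (simp add: complex_eq_iff)
  qed
  define g where "g = Abs_fps (\<lambda>n. Re (fps_nth f n))"
  have "cfps g = f"
    unfolding fps_eq_iff using nth by (simp add: g_def)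
  moreover have "fps_nth g 0 = s"
    using f(2) by (simp add: g_def)
  ultimately show ?thesis
    using f fps_conv_radius_cfps[of g] by (intro exI[of _ g]) simp
qed

subsection \<open>A Hermite--Biehler theorem\<close>

lemma poly_prod_linear_logderiv:
  fixes a :: "'i \<Rightarrow> complex"
  assumes "finite I" "\<And>i. i \<in> I \<Longrightarrow> w + a i \<noteq> 0"
  shows "poly (pderiv (\<Prod>i\<in>I. [:a i, 1:])) w = (\<Prod>i\<in>I. w + a i) * (\<Sum>i\<in>I. 1 / (w + a i))"
  using assms
proof (induction I rule: finite_induct)
  case (insert j I)
  have prod_eval: "poly (\<Prod>i\<in>I. [:a i, 1:]) w = (\<Prod>i\<in>I. w + a i)"
    by (simp add: poly_prod add.commute)
  have "poly (pderiv (\<Prod>i\<in>insert j I. [:a i, 1:])) w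
      = (w + a j) * poly (pderiv (\<Prod>i\<in>I. [:a i, 1:])) w + (\<Prod>i\<in>I. w + a i)"
    using insert.hyps
    by (simp add: pderiv_mult pderiv_pCons prod_eval add.commute del: mult_pCons_left mult_pCons_right)
  also have "\<dots> = (\<Prod>i\<in>insert j I. w + a i) * (\<Sum>i\<in>insert j I. 1 / (w + a i))"
  proof -
    have "poly (pderiv (\<Prod>i\<in>I. [:a i, 1:])) w = (\<Prod>i\<in>I. w + a i) * (\<Sum>i\<in>I. 1 / (w + a i))"
      by (rule insert.IH) (use insert.prems in auto)
    then show ?thesis
      using insert.hyps insert.prems[of j] by (simp add: distrib_left)
  qed
  finally show ?case .
qed simp

text \<open>The combination \<open>A + t B\<close> formed for \<open>C * g\<close> in place of
  \<open>P\<close>. Keeping \<open>C\<close> separate lets \<open>g\<close> be a monic product of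
  linear factors.\<close>

definition hb_poly :: "real \<Rightarrow> complex \<Rightarrow> complex poly \<Rightarrow> complex poly" where
  "hb_poly t C g = smult ((1 - \<i> * t) / 2 * C) g + smult ((1 + \<i> * t) / 2 * cnj C) (map_poly cnj g)"

lemma map_poly_cnj_prod_linear:
  "map_poly cnj (\<Prod>i\<in>I. [:a i, 1:]) = (\<Prod>i\<in>I. [:cnj (a i), 1:])"
proof -
  have "poly (map_poly cnj (\<Prod>i\<in>I. [:a i, 1:])) w = poly (\<Prod>i\<in>I. [:cnj (a i), 1:]) w" for w
    by (simp add: poly_map_poly_cnj poly_prod)
  then show ?thesis by (intro poly_eq_poly_eq_iff[THEN iffD1] ext)
qed

lemma poly_hb_poly_of_real:
  "poly (hb_poly t C g) (of_real s) = of_real (Re (C * poly g (of_real s)) + t * Im (C * poly g (of_real s)))"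
proof -
  have "poly (hb_poly t C g) (of_real s) =
    (1 - \<i> * t) / 2 * (C * poly g (of_real s)) + (1 + \<i> * t) / 2 * cnj (C * poly g (of_real s))"
    by (simp add: hb_poly_def poly_map_poly_cnj mult.assoc)
  also have "\<dots> = of_real (Re z + t * Im z)" if "z = C * poly g (of_real s)" for z
    unfolding that[symmetric] by (simp add: complex_eq_iff field_simps)
  finally show ?thesis by simp
qed

lemma finite_Re_plus_Im_zero: "finite {t. Re z + t * Im z = 0}" if "z \<noteq> 0" for z
proof (cases "Im z = 0")
  case True
  then show ?thesis using that by (simp add: complex_eq_iff)
next
  case False
  then have "{t. Re z + t * Im z = 0} \<subseteq> {- Re z / Im z}"
    by (auto simp: field_simps)
  then show ?thesis by (rule finite_subset) simp
qed

text \<open>Off the real axis \<open>g\<close> and its conjugate have different moduli, so the two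
  terms of \<open>h\<close> cannot cancel and all zeros are real; a logarithmic derivative excludes
  double zeros. The leading coefficient of \<open>h\<close> is \<open>Re C + t * Im C\<close>, so
  the condition on \<open>C\<close> keeps the degree at \<open>card I\<close>.\<close>

lemma hermite_biehler:
  fixes a :: "'i \<Rightarrow> complex"
  assumes "finite I" "I \<noteq> {}" and a: "\<And>i. i \<in> I \<Longrightarrow> Im (a i) > 0"
    and C: "Re C + t * Im C \<noteq> 0"
  defines "h \<equiv> hb_poly t C (\<Prod>i\<in>I. [:a i, 1:])"
  shows "\<exists>S. finite S \<and> card S = card I
           \<and> (\<forall>s\<in>S. poly h (of_real s) = 0 \<and> poly (pderiv h) (of_real s) \<noteq> 0)"
proof -
  define g where "g = (\<Prod>i\<in>I. [:a i, 1:])"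
  define gb where "gb = (\<Prod>i\<in>I. [:cnj (a i), 1:])"
  define \<alpha> where "\<alpha> = (1 - \<i> * t) / 2 * C"
  have h: "h = smult \<alpha> g + smult (cnj \<alpha>) gb"
    by (simp add: h_def hb_poly_def map_poly_cnj_prod_linear g_def gb_def \<alpha>_def)
  have "\<alpha> \<noteq> 0"
    using C by (auto simp: \<alpha>_def complex_eq_iff)
  have g_eval: "poly g w = (\<Prod>i\<in>I. w + a i)" for w
    by (simp add: g_def poly_prod add_ac)
  have gb_eval: "poly gb w = (\<Prod>i\<in>I. w + cnj (a i))" for w
    by (simp add: gb_def poly_prod add_ac)
  have lin: "[:z, 1:] \<noteq> 0" for z :: complex by simp
  have deg_g: "degree g = card I" "degree gb = card I"
    unfolding g_def gb_def using lin by (simp_all add: degree_prod_eq_sum_degree)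
  have lead: "coeff g (card I) = 1" "coeff gb (card I) = 1"
    using lead_coeff_prod[of "\<lambda>i. [:a i, 1:]" I] lead_coeff_prod[of "\<lambda>i. [:cnj (a i), 1:]" I] deg_g
    by (simp_all add: g_def gb_def)
  have "coeff h (card I) = \<alpha> + cnj \<alpha>"
    by (simp add: h lead)
  also have "\<dots> = of_real (Re C + t * Im C)"
    by (simp add: \<alpha>_def complex_eq_iff field_simps)
  finally have "coeff h (card I) \<noteq> 0"
    using C by (simp only: of_real_eq_0_iff not_False_eq_True)
  moreover have "degree h \<le> card I"
    unfolding h using deg_g by (intro degree_add_le order.trans[OF degree_smult_le]) auto
  ultimately have deg: "degree h = card I"
    using le_degree by (metis le_antisym)

  have real: "Im w = 0" if "poly h w = 0" for w
  proof (rule ccontr)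
    assume "Im w \<noteq> 0"
    obtain i0 where i0: "i0 \<in> I" using assms(2) by blast
    \<comment> \<open>Factor by factor, \<open>|w + a|^2 - |w + cnj a|^2 = 4 Im w Im a\<close>,
      whose sign is that of \<open>Im w\<close>.\<close>
    have "norm (poly g w) \<noteq> norm (poly gb w)"
    proof (cases "Im w > 0")
      case True
      have "(\<Prod>i\<in>I. norm (w + cnj (a i))) < (\<Prod>i\<in>I. norm (w + a i))"
      proof -
        have lt: "norm (w + cnj (a i)) < norm (w + a i)" if "i \<in> I" for i
          using a[of i] that True by (auto simp: cmod_def power2_eq_square algebra_simps)
        then show ?thesis
          using assms(1) i0
          by (intro prod_mono_strict[of i0]) (auto intro: less_imp_le le_less_trans[OF norm_ge_zero] simp del: zero_less_norm_iff)
      qed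
      then show ?thesis by (simp add: g_eval gb_eval prod_norm)
    next
      case False
      have "(\<Prod>i\<in>I. norm (w + a i)) < (\<Prod>i\<in>I. norm (w + cnj (a i)))"
      proof -
        have lt: "norm (w + a i) < norm (w + cnj (a i))" if "i \<in> I" for i
          using a[of i] that False \<open>Im w \<noteq> 0\<close> mult_neg_pos[of "Im w" "Im (a i)"]
          by (auto simp: cmod_def power2_eq_square algebra_simps)
        then show ?thesis
          using assms(1) i0
          by (intro prod_mono_strict[of i0]) (auto intro: less_imp_le le_less_trans[OF norm_ge_zero] simp del: zero_less_norm_iff)
      qed
      then show ?thesis by (simp add: g_eval gb_eval prod_norm)
    qed
    moreover have "\<alpha> * poly g w = - (cnj \<alpha> * poly gb w)"
      using that by (simp add: h eq_neg_iff_add_eq_0)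
    then have "norm \<alpha> * norm (poly g w) = norm \<alpha> * norm (poly gb w)"
      using norm_mult[of \<alpha> "poly g w"] norm_mult[of "cnj \<alpha>" "poly gb w"] by auto
    ultimately show False using \<open>\<alpha> \<noteq> 0\<close> by simp
  qed

  have simple: "poly (pderiv h) w \<noteq> 0" if root: "poly h w = 0" for w
  proof
    assume d0: "poly (pderiv h) w = 0"
    have w: "w \<in> \<real>" using real[OF root] by (simp add: complex_is_Real_iff)
    have nz: "w + a i \<noteq> 0" "w + cnj (a i) \<noteq> 0" if "i \<in> I" for i
      using a[OF that] real[OF root] by (auto simp: complex_eq_iff)
    \<comment> \<open>A double zero forces the logarithmic derivative \<open>\<sigma>\<close> of \<open>g\<close> at \<open>w\<close> to be real, but all its terms have negative imaginary part.\<close>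
    define \<sigma> where "\<sigma> = (\<Sum>i\<in>I. 1 / (w + a i))"
    have dg: "poly (pderiv g) w = poly g w * \<sigma>"
      unfolding g_eval unfolding \<sigma>_def g_def using assms(1) nz by (intro poly_prod_linear_logderiv) auto
    have dgb: "poly (pderiv gb) w = poly gb w * cnj \<sigma>"
      unfolding gb_eval unfolding \<sigma>_def gb_def using poly_prod_linear_logderiv[OF assms(1), of w "\<lambda>i. cnj (a i)"] nz w
      by (simp add: Reals_cnj_iff)
    have neg: "cnj \<alpha> * poly gb w = - (\<alpha> * poly g w)"
      using root by (simp add: h add_eq_0_iff)
    have "\<alpha> * poly g w * \<sigma> + cnj \<alpha> * poly gb w * cnj \<sigma> = 0"
      using d0 by (simp add: h pderiv_add pderiv_smult dg dgb mult.assoc)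
    then have "\<alpha> * poly g w * (\<sigma> - cnj \<sigma>) = 0"
      unfolding neg by (simp add: right_diff_distrib)
    moreover have "poly g w \<noteq> 0"
      using nz assms(1) by (simp add: g_eval)
    ultimately have "\<sigma> = cnj \<sigma>"
      using \<open>\<alpha> \<noteq> 0\<close> by simp
    then have "Im \<sigma> = 0"
      by (simp add: complex_eq_iff)
    moreover have "Im \<sigma> < 0"
    proof -
      have "Im (1 / (w + a i)) < 0" if "i \<in> I" for i
      proof -
        have "Im (1 / (w + a i)) = - Im (w + a i) / (norm (w + a i))\<^sup>2"
          by (simp add: Im_divide cmod_power2)
        also have "\<dots> < 0"
          using a[OF that] real[OF root] nz(1)[OF that] by (intro divide_neg_pos) auto
        finally show ?thesis .
      qed
      then have "(\<Sum>i\<in>I. Im (1 / (w + a i))) < (\<Sum>i\<in>I. 0)"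
        using assms(1,2) by (intro sum_strict_mono) auto
      then show ?thesis by (simp add: \<sigma>_def)
    qed
    ultimately show False by simp
  qed

  define S where "S = {s::real. poly h (of_real s) = 0}"
  have "h \<noteq> 0" using deg assms(1,2) by auto
  have img: "of_real ` S = {w. poly h w = 0}"
  proof safe
    fix w assume "poly h w = 0"
    with real[of w] have "w = of_real (Re w)" by (simp add: complex_eq_iff)
    moreover from this \<open>poly h w = 0\<close> have "Re w \<in> S"
      unfolding S_def by simp
    ultimately show "w \<in> of_real ` S" by (rule image_eqI)
  qed (simp add: S_def)
  have fin: "finite {w. poly h w = 0}"
    using \<open>h \<noteq> 0\<close> by (rule poly_roots_finite)
  \<comment> \<open>Simple zeros make the number of zeros equal to the degree.\<close>
  have "rsquarefree h"
    unfolding rsquarefree_roots using simple by blast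
  then have "h = smult (lead_coeff h) (\<Prod>z | poly h z = 0. [:- z, 1:])"
    by (rule complex_poly_decompose_rsquarefree[symmetric])
  then have "degree h = degree (smult (lead_coeff h) (\<Prod>z | poly h z = 0. [:- z, 1:]))"
    by (rule arg_cong)
  also have "\<dots> = degree (\<Prod>z | poly h z = 0. [:- z, 1:])"
    using \<open>h \<noteq> 0\<close> by (subst degree_smult_eq) auto
  also have "\<dots> = card {w. poly h w = 0}"
    using lin by (simp add: degree_prod_eq_sum_degree)
  finally have "card S = card I"
    unfolding img[symmetric] by (simp add: card_image inj_on_def deg)
  moreover have "finite S"
    using fin unfolding img[symmetric] by (rule finite_imageD) (auto simp: inj_on_def)
  ultimately show ?thesis
    using simple by (intro exI[of _ S]) (auto simp: S_def)
qed

subsection \<open>Polynomials over convergent power series\<close>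

definition evalf :: "complex fps poly \<Rightarrow> complex \<Rightarrow> complex \<Rightarrow> complex" where
  "evalf F x y = poly (map_poly (\<lambda>f. eval_fps f x) F) y"

lemma evalf_0 [simp]: "evalf 0 x y = 0"
  by (simp add: evalf_def)

lemma evalf_pCons [simp]: "evalf (pCons a F) x y = eval_fps a x + y * evalf F x y"
  by (simp add: evalf_def map_poly_pCons)

lemma evalf_map_poly_fps_of_poly: "evalf (map_poly fps_of_poly p) x y = eval2 p x y"
  by (induction p) (simp_all add: map_poly_pCons)

text \<open>One radius for all coefficients survives substitution of series and synthetic division,
  so the disc does not shrink as linear factors are split off.\<close>

definition coeffs_conv :: "ereal \<Rightarrow> complex fps poly \<Rightarrow> bool" where
  "coeffs_conv r F \<longleftrightarrow> (\<forall>n. fps_conv_radius (coeff F n) \<ge> r)"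

lemma coeffs_conv_pCons [simp]: "coeffs_conv r (pCons a F) \<longleftrightarrow> fps_conv_radius a \<ge> r \<and> coeffs_conv r F"
  unfolding coeffs_conv_def by (auto simp: coeff_pCons split: nat.splits)

lemma fps_conv_radius_poly:
  assumes "coeffs_conv r F" "fps_conv_radius b \<ge> r"
  shows "fps_conv_radius (poly F b) \<ge> r"
  using assms by (induction F) (auto intro!: fps_conv_radius_add_ge fps_conv_radius_mult_ge)

lemma coeffs_conv_synthetic_div:
  assumes "coeffs_conv r F" "fps_conv_radius b \<ge> r"
  shows "coeffs_conv r (synthetic_div F b)"
  using assms by (induction F) (auto intro!: fps_conv_radius_poly simp: coeffs_conv_def[of r 0])

lemma evalf_synthetic_div:
  assumes "coeffs_conv r F" "fps_conv_radius b \<ge> r" "ereal (norm x) < r"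
  shows "evalf F x y = (y - eval_fps b x) * evalf (synthetic_div F b) x y + eval_fps (poly F b) x"
  using assms
proof (induction F)
  case (pCons a F)
  have r: "fps_conv_radius (poly F b) \<ge> r"
    using pCons.prems by (intro fps_conv_radius_poly) auto
  have A: "eval_fps (poly (pCons a F) b) x = eval_fps a x + eval_fps b x * eval_fps (poly F b) x"
    using pCons.prems r fps_conv_radius_mult_ge[of r b "poly F b"]
    by (simp add: eval_fps_add eval_fps_mult less_le_trans)
  have B: "evalf F x y = (y - eval_fps b x) * evalf (synthetic_div F b) x y + eval_fps (poly F b) x"
    using pCons by simp
  show ?case
    unfolding A evalf_pCons synthetic_div_pCons B by (simp add: algebra_simps)
qed simp

text \<open>Power series form an integral domain, so a root distinct from those already split off is
  a root of the cofactor. The algebraic identity drives the induction; the identity of values is the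
  one needed for the local factorization.\<close>

lemma evalf_factor_distinct_roots:
  assumes "finite J" "inj_on b J" "\<And>j. j \<in> J \<Longrightarrow> poly F (b j) = 0"
    and "\<And>j. j \<in> J \<Longrightarrow> fps_conv_radius (b j) \<ge> r" "coeffs_conv r F"
  shows "\<exists>V. coeffs_conv r V \<and> F = V * (\<Prod>j\<in>J. [:- b j, 1:])
           \<and> (\<forall>x y. ereal (norm x) < r \<longrightarrow> evalf F x y = evalf V x y * (\<Prod>j\<in>J. y - eval_fps (b j) x))"
  using assms
proof (induction J rule: finite_induct)
  case empty
  then show ?case by (intro exI[of _ F]) auto
next
  case (insert j J)
  then obtain V where V: "coeffs_conv r V" "F = V * (\<Prod>j\<in>J. [:- b j, 1:])"
    "\<And>x y. ereal (norm x) < r \<Longrightarrow> evalf F x y = evalf V x y * (\<Prod>j\<in>J. y - eval_fps (b j) x)"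
    by auto
  have "poly V (b j) * (\<Prod>i\<in>J. b j - b i) = 0"
    using insert.prems(2)[of j] V(2) by (simp add: poly_prod)
  moreover have "(\<Prod>i\<in>J. b j - b i) \<noteq> 0"
    using insert by (auto simp: inj_on_def)
  ultimately have root: "poly V (b j) = 0" by simp
  define V' where "V' = synthetic_div V (b j)"
  have "V = [:- b j, 1:] * V'"
    using synthetic_div_correct'[of "b j" V] root by (simp add: V'_def)
  then have "F = V' * (\<Prod>i\<in>insert j J. [:- b i, 1:])"
    using insert.hyps by (subst V(2)) (simp add: mult_ac del: mult_pCons_left mult_pCons_right)
  moreover have "coeffs_conv r V'"
    unfolding V'_def using V(1) insert.prems(3)[of j] by (intro coeffs_conv_synthetic_div) auto
  moreover have "evalf F x y = evalf V' x y * (\<Prod>i\<in>insert j J. y - eval_fps (b i) x)" if "ereal (norm x) < r" for x y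
    using V(3)[OF that, of y] evalf_synthetic_div[OF V(1) insert.prems(3)[of j] that, of y] root insert.hyps
    by (simp add: V'_def mult_ac)
  ultimately show ?case by blast
qed

section \<open>Polynomials in \<open>y\<close> with convergent coefficients as double power
  series\<close>

lemma has_sum_column:
  fixes f :: "nat \<Rightarrow> 'a::real_normed_vector"
  assumes "(f has_sum s) UNIV"
  shows "((\<lambda>(m, n). if n = k then f m else 0) has_sum s) UNIV"
proof -
  have "((\<lambda>(m, n). f m) has_sum s) ((\<lambda>m. (m, k)) ` UNIV)"
    using assms by (subst has_sum_reindex) (auto simp: inj_on_def o_def)
  then show ?thesis
    by (subst has_sum_cong_neutral[where T = "(\<lambda>m. (m, k)) ` UNIV" and g = "\<lambda>(m, n). f m"]) auto
qed

text \<open>Only the columns \<open>n \<le> d\<close> are nonzero, so the sum over pairs is a finite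
  sum of single series.\<close>

lemma has_sum_poly_fps:
  fixes c :: "nat \<Rightarrow> nat \<Rightarrow> 'a::real_normed_vector"
  assumes "\<And>n. n \<le> d \<Longrightarrow> ((\<lambda>m. c m n) has_sum s n) UNIV" "\<And>m n. n > d \<Longrightarrow> c m n = 0"
  shows "((\<lambda>(m, n). c m n) has_sum (\<Sum>n\<le>d. s n)) UNIV"
proof -
  have "((\<lambda>p. \<Sum>k\<in>K. (\<lambda>(m, n). if n = k then c m k else 0) p) has_sum (\<Sum>n\<in>K. s n)) UNIV"
    if "finite K" "K \<subseteq> {..d}" for K
    using that
  proof (induction K rule: finite_induct)
    case (insert k K)
    then show ?case
      using has_sum_add[OF has_sum_column[OF assms(1)[of k], of k]] by simp
  qed simp
  from this[of "{..d}"]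
  have "((\<lambda>p. \<Sum>k\<le>d. (\<lambda>(m, n). if n = k then c m k else 0) p) has_sum (\<Sum>n\<le>d. s n)) UNIV"
    by simp
  moreover have "(\<Sum>k\<le>d. (\<lambda>(m, n). if n = k then c m k else 0) p) = (\<lambda>(m, n). c m n) p" for p
    using assms(2)[of "snd p" "fst p"] by (cases p) (auto simp: sum.delta)
  ultimately show ?thesis by simp
qed

lemma eval_ps2_coeffs:
  assumes "coeffs_conv r V" "ereal (norm x) < r"
  shows "eval_ps2 (\<lambda>m n. fps_nth (coeff V n) m) x y = evalf V x y"
proof -
  have "((\<lambda>m. fps_nth (coeff V n) m * x ^ m * y ^ n) has_sum (eval_fps (coeff V n) x * y ^ n)) UNIV" for n
  proof (intro has_sum_cmult_left norm_summable_imp_has_sum)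
    have "norm x < fps_conv_radius (coeff V n)"
      using assms by (meson coeffs_conv_def less_le_trans)
    then show "summable (\<lambda>m. norm (fps_nth (coeff V n) m * x ^ m))"
      "(\<lambda>m. fps_nth (coeff V n) m * x ^ m) sums eval_fps (coeff V n) x"
      by (rule norm_summable_fps, rule sums_eval_fps)
  qed
  then have "((\<lambda>(m, n). fps_nth (coeff V n) m * x ^ m * y ^ n)
               has_sum (\<Sum>n\<le>degree V. eval_fps (coeff V n) x * y ^ n)) UNIV"
    by (intro has_sum_poly_fps) (auto simp: coeff_eq_0)
  \<comment> \<open>Evaluating the coefficients at \<open>x\<close> may lower the degree in
    \<open>y\<close>; the surplus terms have coefficient 0.\<close>
  moreover have "(\<Sum>n\<le>degree V. eval_fps (coeff V n) x * y ^ n) = evalf V x y"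
    unfolding evalf_def poly_altdef
  proof (intro sum.mono_neutral_cong_right ballI)
    show "{..degree (map_poly (\<lambda>f. eval_fps f x) V)} \<subseteq> {..degree V}"
      by (auto intro!: degree_le order.trans[OF _ degree_le[of "degree V"]] simp: coeff_map_poly coeff_eq_0)
    show "eval_fps (coeff V i) x * y ^ i = 0"
      if "i \<in> {..degree V} - {..degree (map_poly (\<lambda>f. eval_fps f x) V)}" for i
      using that coeff_eq_0[of "map_poly (\<lambda>f. eval_fps f x) V" i] by (simp add: coeff_map_poly)
  qed (simp_all add: coeff_map_poly)
  ultimately show ?thesis
    unfolding eval_ps2_def by (simp add: infsumI)
qed

lemma conv_ps2_coeffs:
  assumes "coeffs_conv r V" "r > 0"
  shows "conv_ps2 (\<lambda>m n. fps_nth (coeff V n) m)"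
proof -
  obtain \<rho> :: real where \<rho>: "0 < \<rho>" "ereal \<rho> < r"
    using ereal_dense2[OF assms(2)] by auto
  have "((\<lambda>m. norm (fps_nth (coeff V n) m) * \<rho> ^ (m + n))
      has_sum (suminf (\<lambda>m. norm (fps_nth (coeff V n) m * of_real \<rho> ^ m)) * \<rho> ^ n)) UNIV" for n
  proof -
    have "norm (complex_of_real \<rho>) < fps_conv_radius (coeff V n)"
      using assms \<rho> by (auto simp: coeffs_conv_def intro: less_le_trans)
    then have "summable (\<lambda>m. norm (fps_nth (coeff V n) m * of_real \<rho> ^ m))"
      by (rule norm_summable_fps)
    then have "((\<lambda>m. norm (fps_nth (coeff V n) m * of_real \<rho> ^ m) * \<rho> ^ n)
      has_sum (suminf (\<lambda>m. norm (fps_nth (coeff V n) m * of_real \<rho> ^ m)) * \<rho> ^ n)) UNIV"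
      by (intro has_sum_cmult_left norm_summable_imp_has_sum) (auto simp: summable_sums)
    then show ?thesis
      using \<rho> by (simp add: norm_mult norm_power power_add mult.assoc)
  qed
  then have "((\<lambda>(m, n). norm (fps_nth (coeff V n) m) * \<rho> ^ (m + n)) has_sum
      (\<Sum>n\<le>degree V. suminf (\<lambda>m. norm (fps_nth (coeff V n) m * of_real \<rho> ^ m)) * \<rho> ^ n)) UNIV"
    by (intro has_sum_poly_fps) (auto simp: coeff_eq_0)
  then show ?thesis
    unfolding conv_ps2_def using \<rho> by (auto simp: summable_on_def)
qed

subsection \<open>Limits at the origin\<close>

text \<open>With \<open>s = max (norm x) (norm y) / \<rho>\<close> at most 1, every term of positive
  total degree is at most \<open>s\<close> times its term in the convergent majorant, so everything
  beyond the constant term is bounded by \<open>s * T\<close>.\<close>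

lemma eval_ps2_near_0:
  assumes "conv_ps2 c"
  shows "\<exists>K \<rho>. \<rho> > 0 \<and> (\<forall>x y. norm x \<le> \<rho> \<longrightarrow> norm y \<le> \<rho> \<longrightarrow>
           norm (eval_ps2 c x y - c 0 0) \<le> K * max (norm x) (norm y))"
proof -
  obtain \<rho> where \<rho>: "\<rho> > 0" "(\<lambda>(m, n). norm (c m n) * \<rho> ^ (m + n)) summable_on UNIV"
    using assms unfolding conv_ps2_def by blast
  define T where "T = (\<Sum>\<^sub>\<infinity>(m, n)\<in>UNIV. norm (c m n) * \<rho> ^ (m + n))"
  have T: "((\<lambda>(m, n). norm (c m n) * \<rho> ^ (m + n)) has_sum T) UNIV"
    unfolding T_def using \<rho>(2) by (rule has_sum_infsum)
  have "norm (eval_ps2 c x y - c 0 0) \<le> T / \<rho> * max (norm x) (norm y)"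
    if xy: "norm x \<le> \<rho>" "norm y \<le> \<rho>" for x y
  proof -
    define s where "s = max (norm x) (norm y) / \<rho>"
    have s: "0 \<le> s" "s \<le> 1" "norm x \<le> s * \<rho>" "norm y \<le> s * \<rho>"
      using xy \<rho>(1) by (auto simp: s_def le_max_iff_disj intro!: divide_nonneg_pos)
    have bound: "norm (c m n * x ^ m * y ^ n) \<le> s ^ (m + n) * (norm (c m n) * \<rho> ^ (m + n))" for m n
    proof -
      have "norm (c m n * x ^ m * y ^ n) = norm (c m n) * (norm x ^ m * norm y ^ n)"
        by (simp add: norm_mult norm_power mult.assoc)
      also have "\<dots> \<le> norm (c m n) * ((s * \<rho>) ^ m * (s * \<rho>) ^ n)"
        using s \<rho>(1) by (intro mult_left_mono mult_mono power_mono) auto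
      finally show ?thesis
        by (simp add: power_add power_mult_distrib mult_ac)
    qed
    have "(\<lambda>(m, n). c m n * x ^ m * y ^ n) summable_on UNIV"
    proof (rule abs_summable_summable, rule summable_on_comparison_test[OF \<rho>(2)])
      fix p :: "nat \<times> nat"
      obtain m n where p: "p = (m, n)" by (cases p)
      have "s ^ (m + n) * (norm (c m n) * \<rho> ^ (m + n)) \<le> 1 * (norm (c m n) * \<rho> ^ (m + n))"
        using s \<rho>(1) by (intro mult_right_mono power_le_one) auto
      with bound[of m n] show "norm (case p of (m, n) \<Rightarrow> c m n * x ^ m * y ^ n)
          \<le> (case p of (m, n) \<Rightarrow> norm (c m n) * \<rho> ^ (m + n))"
        by (simp add: p)
    qed auto
    then have "((\<lambda>(m, n). c m n * x ^ m * y ^ n) has_sum eval_ps2 c x y) UNIV"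
      unfolding eval_ps2_def by (rule has_sum_infsum)
    \<comment> \<open>The constant term is removed by adding a family supported at the index
      \<open>(0, 0)\<close>.\<close>
    moreover have "((\<lambda>p. if p = (0, 0) then - c 0 0 else 0) has_sum (- c 0 0)) (UNIV :: (nat \<times> nat) set)"
      by (rule has_sum_finite_neutralI[where B = "{(0, 0)}"]) auto
    ultimately have "((\<lambda>p. (case p of (m, n) \<Rightarrow> c m n * x ^ m * y ^ n) + (if p = (0, 0) then - c 0 0 else 0))
        has_sum (eval_ps2 c x y + - c 0 0)) UNIV"
      by (rule has_sum_add)
    then have "norm (eval_ps2 c x y + - c 0 0) \<le> s * T"
    proof (rule norm_infsum_le)
      show "((\<lambda>p. s * (case p of (m, n) \<Rightarrow> norm (c m n) * \<rho> ^ (m + n))) has_sum s * T) UNIV"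
        using T by (rule has_sum_cmult_right)
      fix p :: "nat \<times> nat"
      obtain m n where p: "p = (m, n)" by (cases p)
      show "norm ((case p of (m, n) \<Rightarrow> c m n * x ^ m * y ^ n) + (if p = (0, 0) then - c 0 0 else 0))
          \<le> s * (case p of (m, n) \<Rightarrow> norm (c m n) * \<rho> ^ (m + n))"
      proof (cases "p = (0, 0)")
        case True
        then show ?thesis using s by (auto simp: p)
      next
        case False
        then have "s ^ (m + n) \<le> s ^ 1"
          using s by (intro power_decreasing) (auto simp: p)
        then have "s ^ (m + n) * (norm (c m n) * \<rho> ^ (m + n)) \<le> s * (norm (c m n) * \<rho> ^ (m + n))"
          using \<rho>(1) by (intro mult_right_mono) auto
        with bound[of m n] False show ?thesis by (auto simp: p)
      qed
    qed
    then show ?thesis by (simp add: s_def mult_ac)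
  qed
  with \<rho>(1) show ?thesis by blast
qed

lemma tendsto_eval_ps2_0:
  assumes "conv_ps2 c" "(f \<longlongrightarrow> 0) F" "(g \<longlongrightarrow> 0) F"
  shows "((\<lambda>z. eval_ps2 c (f z) (g z)) \<longlongrightarrow> c 0 0) F"
proof -
  obtain K \<rho> where K: "\<rho> > 0" "\<And>x y. norm x \<le> \<rho> \<Longrightarrow> norm y \<le> \<rho> \<Longrightarrow>
           norm (eval_ps2 c x y - c 0 0) \<le> K * max (norm x) (norm y)"
    using eval_ps2_near_0[OF assms(1)] by blast
  have "((\<lambda>z. eval_ps2 c (f z) (g z) - c 0 0) \<longlongrightarrow> 0) F"
  proof (rule Lim_null_comparison)
    have "\<forall>\<^sub>F z in F. norm (f z) < \<rho>" "\<forall>\<^sub>F z in F. norm (g z) < \<rho>"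
      using order_tendstoD(2)[OF tendsto_norm_zero[OF assms(2)] K(1)]
        order_tendstoD(2)[OF tendsto_norm_zero[OF assms(3)] K(1)] by auto
    then show "\<forall>\<^sub>F z in F. norm (eval_ps2 c (f z) (g z) - c 0 0) \<le> K * max (norm (f z)) (norm (g z))"
      by eventually_elim (intro K(2), auto)
    have "((\<lambda>z. K * max (norm (f z)) (norm (g z))) \<longlongrightarrow> K * max (norm (0::complex)) (norm (0::complex))) F"
      by (intro tendsto_intros assms(2,3))
    then show "((\<lambda>z. K * max (norm (f z)) (norm (g z))) \<longlongrightarrow> 0) F" by simp
  qed
  then show ?thesis by (simp add: LIM_zero_iff)
qed

lemma tendsto_poly_divide_power:
  fixes p :: "complex poly"
  assumes "\<And>k. k < n \<Longrightarrow> coeff p k = 0"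
  shows "((\<lambda>x::real. poly p (of_real x) / of_real x ^ n) \<longlongrightarrow> coeff p n) (at_right 0)"
proof -
  obtain p' where p': "p = monom 1 n * p'"
    using assms monom_1_dvd_iff'[of n p] by (auto elim: dvdE)
  have "((\<lambda>x::real. poly p' (of_real x)) \<longlongrightarrow> poly p' (of_real 0)) (at_right 0)"
    by (intro tendsto_intros)
  moreover have "poly p' (of_real 0) = coeff p n"
    by (simp add: p' coeff_monom_mult poly_0_coeff_0)
  moreover have "\<forall>\<^sub>F x in at_right (0::real). poly p' (of_real x) = poly p (of_real x) / of_real x ^ n"
    using eventually_at_right_less[of 0] by eventually_elim (simp add: p' poly_monom)
  ultimately show ?thesis
    using Lim_transform_eventually by fastforce
qed

lemma tendsto_power_divide_power:
  assumes "n \<le> a"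
  shows "((\<lambda>x::real. of_real x ^ a / of_real x ^ n :: complex) \<longlongrightarrow> (if n = a then 1 else 0)) (at_right 0)"
  using tendsto_poly_divide_power[of n "monom 1 a"] assms by (simp add: poly_monom eq_commute)

text \<open>At positive real \<open>x\<close> the principal complex power is the real one, which
  tends to 0 because its exponent is positive.\<close>

lemma tendsto_eval_fps_powr:
  fixes \<psi> :: "complex fps"
  assumes "fps_conv_radius \<psi> > 0" "k \<ge> 1"
  shows "((\<lambda>x::real. eval_fps \<psi> (of_real x powr (1 / of_nat k))) \<longlongrightarrow> fps_nth \<psi> 0) (at_right 0)"
proof -
  have "((\<lambda>x::real. x powr (1 / real k)) \<longlongrightarrow> 0 powr (1 / real k)) (at_right 0)"
    using assms(2) by (intro tendsto_powr2 tendsto_intros) (auto simp: eventually_at_right_less less_imp_le eventually_mono[OF eventually_at_right_less])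
  then have "((\<lambda>x::real. complex_of_real (x powr (1 / real k))) \<longlongrightarrow> of_real 0) (at_right 0)"
    by (intro tendsto_of_real) simp
  moreover have "\<forall>\<^sub>F x in at_right (0::real). complex_of_real (x powr (1 / real k)) = of_real x powr (1 / of_nat k)"
    using eventually_at_right_less[of 0]
    by eventually_elim (simp add: powr_of_real[symmetric])
  ultimately have lim: "((\<lambda>x::real. complex_of_real x powr (1 / of_nat k)) \<longlongrightarrow> 0) (at_right 0)"
    using Lim_transform_eventually by fastforce
  have "isCont (eval_fps \<psi>) 0"
    using assms(1) by (intro continuous_eval_fps) (simp add: zero_ereal_def)
  then have "((\<lambda>x::real. eval_fps \<psi> (of_real x powr (1 / of_nat k))) \<longlongrightarrow> eval_fps \<psi> 0) (at_right 0)"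
    using lim by (rule isCont_tendsto_compose)
  then show ?thesis by (simp add: eval_fps_at_0)
qed

text \<open>In use, \<open>a\<close> and \<open>b\<close> are \<open>2 * L r\<close> and
  \<open>2 * L i\<close>, \<open>n\<close> is the order \<open>Oij q L r i\<close>, and
  \<open>w\<close> is the blow-up coordinate. A power of \<open>x\<close> survives in the limit only
  if its exponent is exactly \<open>n\<close>.\<close>

lemma tendsto_factor:
  fixes p :: "complex poly" and \<psi> :: "complex fps"
  assumes "\<And>k. k < n \<Longrightarrow> coeff p k = 0" "n \<le> a" "n \<le> b" "fps_conv_radius \<psi> > 0" "k \<ge> 1"
  shows "((\<lambda>x::real. (poly p (of_real x) + of_real x ^ a * w
             + of_real x ^ b * eval_fps \<psi> (of_real x powr (1 / of_nat k))) / of_real x ^ n)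
           \<longlongrightarrow> coeff p n + (if n = a then w else 0) + (if n = b then fps_nth \<psi> 0 else 0)) (at_right 0)"
proof -
  have "((\<lambda>x::real. poly p (of_real x) / of_real x ^ n + of_real x ^ a / of_real x ^ n * w
             + of_real x ^ b / of_real x ^ n * eval_fps \<psi> (of_real x powr (1 / of_nat k)))
      \<longlongrightarrow> coeff p n + (if n = a then 1 else 0) * w + (if n = b then 1 else 0) * fps_nth \<psi> 0) (at_right 0)"
    by (intro tendsto_add tendsto_mult tendsto_poly_divide_power tendsto_power_divide_power
        tendsto_eval_fps_powr tendsto_const assms)
  then show ?thesis
    by (simp add: add_divide_distrib if_distrib[of "\<lambda>z. z * _"] cong: if_cong)
qed

text \<open>The minimum is finite even for equal polynomials, whose difference has infinite
  \<open>Ord\<close>. The final disjunction records which of the three quantities attains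
  it.\<close>

lemma Oij_cases:
  obtains n where "Oij q L i j = enat n" "n \<le> 2 * L j" "n \<le> 2 * L i"
    "\<And>k. k < n \<Longrightarrow> coeff (q j - q i) k = 0"
    "n = 2 * L j \<or> n = 2 * L i \<or> coeff (q j - q i) n \<noteq> 0"
proof (cases "q j - q i = 0")
  case True
  show thesis
    by (rule that[of "min (2 * L j) (2 * L i)"]) (use True in \<open>auto simp: Oij_def Ord_def min_def\<close>)
next
  case False
  define d where "d = subdegree (fps_of_poly (q j - q i))"
  have nz: "fps_of_poly (q j - q i) \<noteq> 0"
    using False by (metis fps_of_poly_eq_iff fps_of_poly_0)
  have "Oij q L i j = enat (min d (min (2 * L j) (2 * L i)))"
    using nz by (simp add: Oij_def Ord_def d_def min_def)
  moreover have "coeff (q j - q i) k = 0" if "k < d" for k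
    using nth_less_subdegree_zero[of k "fps_of_poly (q j - q i)"] that by (simp add: d_def)
  moreover have "coeff (q j - q i) d \<noteq> 0"
    using nth_subdegree_nonzero[OF nz] by (simp add: d_def)
  ultimately show thesis
    by (intro that[of "min d (min (2 * L j) (2 * L i))"]) (auto simp: min_def split: if_splits)
qed

lemma Ord_eqI:
  assumes "\<And>k. k < n \<Longrightarrow> fps_nth f k = 0" "fps_nth f n \<noteq> 0"
  shows "Ord f = enat n"
  using assms by (auto simp: Ord_def intro: subdegreeI)

section \<open>Substitution of power series for \<open>y\<close> in bivariate polynomials\<close>

lemma fps_eval_add:
  "poly (map_poly fps_of_poly (A + B)) f = poly (map_poly fps_of_poly A) f + poly (map_poly fps_of_poly B) f"
  for f :: "complex fps"
proof -
  have "map_poly fps_of_poly (A + B) = map_poly fps_of_poly A + map_poly fps_of_poly B"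
    by (rule poly_eqI) (simp add: coeff_map_poly fps_of_poly_add)
  then show ?thesis by simp
qed

lemma fps_eval_smult:
  "poly (map_poly fps_of_poly (smult a B)) f = fps_of_poly a * poly (map_poly fps_of_poly B) f"
  for f :: "complex fps"
proof -
  have "map_poly fps_of_poly (smult a B) = smult (fps_of_poly a) (map_poly fps_of_poly B)"
    by (rule poly_eqI) (simp add: coeff_map_poly fps_of_poly_mult)
  then show ?thesis by simp
qed

lemma fps_eval_mult:
  "poly (map_poly fps_of_poly (A * B)) f = poly (map_poly fps_of_poly A) f * poly (map_poly fps_of_poly B) f"
  for f :: "complex fps"
  by (induction A) (simp_all add: fps_eval_add fps_eval_smult map_poly_pCons distrib_right mult.assoc)

lemma fps_eval_pcompose:
  "poly (map_poly fps_of_poly (pcompose p [:a, b:])) f = poly (map_poly fps_of_poly p) (fps_of_poly a + f * fps_of_poly b)"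
  for f :: "complex fps"
  by (induction p) (simp_all add: pcompose_pCons fps_eval_add fps_eval_mult map_poly_pCons del: mult_pCons_left mult_pCons_right)

subsection \<open>Blowing up along the data of a factorization\<close>

text \<open>The coefficient of \<open>y^M\<close> in \<open>P(0, y)\<close> enters as a nonzero real
  number because it turns out to be the value at the origin of the unit in
  \<open>local_factorization\<close>.\<close>

locale stable_factorization =
  fixes P :: "complex poly poly" and k :: nat and L :: "nat \<Rightarrow> nat" and q :: "nat \<Rightarrow> real poly"
    and \<psi> :: "nat \<Rightarrow> complex fps" and u :: "nat \<Rightarrow> nat \<Rightarrow> complex" and M :: nat
  assumes coeff_at_x0: "coeff (at_x0 P) M \<noteq> 0" "coeff (at_x0 P) M \<in> \<real>"
    and k: "k \<ge> 1"
    and u: "unit_ps2 u"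
    and q0: "\<And>j. j < M \<Longrightarrow> poly (q j) 0 = 0"
    and qdeg: "\<And>j. j < M \<Longrightarrow> degree (q j) < 2 * L j"
    and \<psi>conv: "\<And>j. j < M \<Longrightarrow> fps_conv_radius (\<psi> j) > 0"
    and \<psi>Im: "\<And>j. j < M \<Longrightarrow> Im (fps_nth (\<psi> j) 0) > 0"
    and factorization: "\<exists>r>0. \<forall>x y. norm x < r \<longrightarrow> norm y < r \<longrightarrow>
        eval2 P x y = eval_ps2 u x y *
          (\<Prod>j<M. y + poly (map_poly complex_of_real (q j)) x
                    + x ^ (2 * L j) * eval_fps (\<psi> j) (x powr (1 / of_nat k)))"
begin

abbreviation qc :: "nat \<Rightarrow> complex poly" where
  "qc j \<equiv> map_poly complex_of_real (q j)"

definition ord_nat :: "nat \<Rightarrow> nat \<Rightarrow> nat" where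
  "ord_nat r i = the_enat (Oij q L r i)"

lemma ord_nat:
  "ord_nat r i \<le> 2 * L i" "ord_nat r i \<le> 2 * L r"
  "m < ord_nat r i \<Longrightarrow> coeff (q i - q r) m = 0"
  "ord_nat r i = 2 * L i \<or> ord_nat r i = 2 * L r \<or> coeff (q i - q r) (ord_nat r i) \<noteq> 0"
  by (rule Oij_cases[of q L r i]; simp add: ord_nat_def)+

definition same :: "nat \<Rightarrow> nat set" where
  "same r = {i. i < M \<and> L i = L r \<and> q i = q r}"

text \<open>Such factors follow \<open>- q r\<close> up to order \<open>2 * L r\<close>, while
  \<open>\<psi> i\<close> enters only at the higher order \<open>2 * L i\<close>. After the blow-up
  at \<open>r\<close> they therefore leave real linear forms in \<open>w\<close>.\<close>

definition deeper :: "nat \<Rightarrow> nat set" where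
  "deeper r = {i. i < M \<and> L r < L i \<and> (\<forall>m<2 * L r. coeff (q i - q r) m = 0)}"

text \<open>The limit of factor \<open>i\<close> on the curve
  \<open>y = - q r + x^(2 * L r) * w\<close>, divided by \<open>x\<close> to the power
  \<open>ord_nat r i\<close>.\<close>

definition lim_factor :: "nat \<Rightarrow> nat \<Rightarrow> complex \<Rightarrow> complex" where
  "lim_factor r i w = of_real (coeff (q i - q r) (ord_nat r i))
     + (if ord_nat r i = 2 * L r then w else 0) + (if ord_nat r i = 2 * L i then fps_nth (\<psi> i) 0 else 0)"

text \<open>The remaining factors have order below \<open>2 * L r\<close>, so their limits do not
  depend on \<open>w\<close> and can be taken at \<open>w = 0\<close>.\<close>

definition lead :: "nat \<Rightarrow> complex" where
  "lead r = u 0 0 * (\<Prod>i\<in>{..<M} - same r - deeper r. lim_factor r i 0)"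

definition same_poly :: "nat \<Rightarrow> complex poly" where
  "same_poly r = (\<Prod>i\<in>same r. [:fps_nth (\<psi> i) 0, 1:])"

definition deeper_poly :: "nat \<Rightarrow> complex poly" where
  "deeper_poly r = (\<Prod>i\<in>deeper r. [:of_real (coeff (q i - q r) (2 * L r)), 1:])"

lemma finite_same [simp]: "finite (same r)" and finite_deeper [simp]: "finite (deeper r)"
  by (simp_all add: same_def deeper_def)

lemma ord_nat_same: "i \<in> same r \<Longrightarrow> ord_nat r i = 2 * L r"
  using ord_nat[where r = r and i = i] by (auto simp: same_def)

lemma ord_nat_deeper: "i \<in> deeper r \<Longrightarrow> ord_nat r i = 2 * L r"
  using ord_nat[where r = r and i = i] by (auto simp: deeper_def le_less)

text \<open>Order \<open>2 * L r\<close> forces \<open>q i\<close> and \<open>q r\<close> to agree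
  below that degree and \<open>L r \<le> L i\<close>. Strict inequality puts \<open>i\<close> into
  \<open>deeper r\<close>; equality bounds both degrees below \<open>2 * L r\<close>, so the
  polynomials coincide and \<open>i\<close> lies in \<open>same r\<close>.\<close>

lemma ord_nat_rest:
  assumes "r < M" "i < M" "i \<notin> same r" "i \<notin> deeper r"
  shows "ord_nat r i \<noteq> 2 * L r"
proof
  assume n: "ord_nat r i = 2 * L r"
  then have vanish: "\<forall>m<2 * L r. coeff (q i - q r) m = 0" and le: "L r \<le> L i"
    using ord_nat[where r = r and i = i] by auto
  then have "L i = L r"
    using assms by (auto simp: deeper_def)
  then have "coeff (q i) m = coeff (q r) m" for m
    using vanish coeff_eq_0[of "q i" m] coeff_eq_0[of "q r" m] qdeg[of i] qdeg[of r] assms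
    by (cases "m < 2 * L r") auto
  then have "q i = q r" by (rule poly_eqI)
  with \<open>L i = L r\<close> assms show False by (simp add: same_def)
qed

text \<open>For a remaining factor, either the order is \<open>2 * L i\<close> and the limit has
  positive imaginary part from \<open>\<psi> i\<close>, or the limit is a nonzero coefficient of
  \<open>q i - q r\<close>.\<close>

lemma lead_nonzero: "r < M \<Longrightarrow> lead r \<noteq> 0"
proof -
  assume r: "r < M"
  have "lim_factor r i 0 \<noteq> 0" if "i \<in> {..<M} - same r - deeper r" for i
    using ord_nat(4)[of r i] ord_nat_rest[OF r, of i] \<psi>Im[of i] that
    by (auto simp: lim_factor_def complex_eq_iff)
  then show ?thesis using u by (auto simp: lead_def unit_ps2_def)
qed

lemma prod_lim_factor:
  assumes "r < M"
  shows "u 0 0 * (\<Prod>i<M. lim_factor r i w) = lead r * poly (same_poly r) w * poly (deeper_poly r) w"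
proof -
  define rest where "rest = {..<M} - same r - deeper r"
  have disj: "same r \<inter> deeper r = {}" by (auto simp: same_def deeper_def)
  have "{..<M} = rest \<union> (same r \<union> deeper r)"
    by (auto simp: rest_def same_def deeper_def)
  then have "(\<Prod>i<M. lim_factor r i w) = (\<Prod>i\<in>rest \<union> (same r \<union> deeper r). lim_factor r i w)"
    by simp
  also have "\<dots> = (\<Prod>i\<in>rest. lim_factor r i w) * ((\<Prod>i\<in>same r. lim_factor r i w) * (\<Prod>i\<in>deeper r. lim_factor r i w))"
    using disj by (subst prod.union_disjoint; (subst prod.union_disjoint)?) (auto simp: rest_def)
  also have "(\<Prod>i\<in>rest. lim_factor r i w) = (\<Prod>i\<in>rest. lim_factor r i 0)"
    using ord_nat_rest[OF assms] by (intro prod.cong) (auto simp: rest_def lim_factor_def)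
  also have "(\<Prod>i\<in>same r. lim_factor r i w) = poly (same_poly r) w"
    unfolding same_poly_def poly_prod
    by (intro prod.cong refl, frule ord_nat_same) (auto simp: lim_factor_def same_def)
  also have "(\<Prod>i\<in>deeper r. lim_factor r i w) = poly (deeper_poly r) w"
    unfolding deeper_poly_def poly_prod
    by (intro prod.cong refl, frule ord_nat_deeper) (auto simp: lim_factor_def deeper_def)
  finally show ?thesis by (simp add: lead_def rest_def mult_ac)
qed

text \<open>Each factor is divided by its own power of \<open>x\<close>, so the exponents add up and
  the limit is taken factor by factor.\<close>

lemma tendsto_P_blowup:
  assumes r: "r < M"
  shows "((\<lambda>x::real. eval2 P (of_real x) (- poly (qc r) (of_real x) + w * of_real x ^ (2 * L r))
             / of_real x ^ (\<Sum>i<M. ord_nat r i))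
          \<longlongrightarrow> lead r * poly (same_poly r) w * poly (deeper_poly r) w) (at_right 0)"
proof -
  define Y where "Y = (\<lambda>x::real. - poly (qc r) (of_real x) + w * of_real x ^ (2 * L r))"
  obtain \<rho> where \<rho>: "\<rho> > 0" "\<And>x y. norm x < \<rho> \<Longrightarrow> norm y < \<rho> \<Longrightarrow>
      eval2 P x y = eval_ps2 u x y * (\<Prod>j<M. y + poly (qc j) x
                    + x ^ (2 * L j) * eval_fps (\<psi> j) (x powr (1 / of_nat k)))"
    using factorization by blast
  have qc0: "poly (qc r) 0 = 0"
    using q0[OF r] by (simp add: poly_0_coeff_0 coeff_map_poly)
  \<comment> \<open>Positivity of \<open>L r\<close> makes the curve \<open>Y\<close> run into the
    origin for every \<open>w\<close>, where the local factorization applies.\<close>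
  have L: "L r > 0" using qdeg[OF r] by simp
  have id: "((\<lambda>x::real. complex_of_real x) \<longlongrightarrow> 0) (at_right 0)"
    by (rule tendsto_eq_intros | simp)+
  have "(Y \<longlongrightarrow> - poly (qc r) 0 + w * 0 ^ (2 * L r)) (at_right 0)"
    unfolding Y_def by (intro tendsto_intros id)
  then have Y: "(Y \<longlongrightarrow> 0) (at_right 0)" using qc0 L by (simp add: power_0_left)
  have lim: "((\<lambda>x. eval_ps2 u (of_real x) (Y x) * (\<Prod>i<M. (poly (qc i - qc r) (of_real x) + of_real x ^ (2 * L r) * w
             + of_real x ^ (2 * L i) * eval_fps (\<psi> i) (of_real x powr (1 / of_nat k))) / of_real x ^ ord_nat r i))
       \<longlongrightarrow> u 0 0 * (\<Prod>i<M. coeff (qc i - qc r) (ord_nat r i) + (if ord_nat r i = 2 * L r then w else 0)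
            + (if ord_nat r i = 2 * L i then fps_nth (\<psi> i) 0 else 0))) (at_right 0)"
  proof (intro tendsto_mult tendsto_prod tendsto_factor)
    show "((\<lambda>x. eval_ps2 u (of_real x) (Y x)) \<longlongrightarrow> u 0 0) (at_right 0)"
      using u id Y by (intro tendsto_eval_ps2_0) (auto simp: unit_ps2_def)
    show "coeff (qc i - qc r) m = 0" if "m < ord_nat r i" for i m
      using ord_nat(3)[OF that] by (simp add: coeff_map_poly)
  qed (use ord_nat \<psi>conv k in auto)
  have prod_eq: "(\<Prod>i<M. coeff (qc i - qc r) (ord_nat r i) + (if ord_nat r i = 2 * L r then w else 0)
            + (if ord_nat r i = 2 * L i then fps_nth (\<psi> i) 0 else 0)) = (\<Prod>i<M. lim_factor r i w)"
    by (simp add: lim_factor_def coeff_map_poly)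
  have ev: "\<forall>\<^sub>F x in at_right 0. eval_ps2 u (of_real x) (Y x)
      * (\<Prod>i<M. (poly (qc i - qc r) (of_real x) + of_real x ^ (2 * L r) * w
             + of_real x ^ (2 * L i) * eval_fps (\<psi> i) (of_real x powr (1 / of_nat k))) / of_real x ^ ord_nat r i)
      = eval2 P (of_real x) (Y x) / of_real x ^ (\<Sum>i<M. ord_nat r i)"
  proof -
    have "\<forall>\<^sub>F x in at_right 0. norm (complex_of_real x) < \<rho>" "\<forall>\<^sub>F x in at_right 0. norm (Y x) < \<rho>"
      using order_tendstoD(2)[OF tendsto_norm_zero[OF id] \<rho>(1)]
        order_tendstoD(2)[OF tendsto_norm_zero[OF Y] \<rho>(1)] by auto
    then show ?thesis
    proof eventually_elim
      case (elim x)
      have "(\<Prod>i<M. (poly (qc i - qc r) (of_real x) + of_real x ^ (2 * L r) * w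
             + of_real x ^ (2 * L i) * eval_fps (\<psi> i) (of_real x powr (1 / of_nat k))) / of_real x ^ ord_nat r i)
         = (\<Prod>i<M. Y x + poly (qc i) (of_real x)
             + of_real x ^ (2 * L i) * eval_fps (\<psi> i) (of_real x powr (1 / of_nat k))) / of_real x ^ (\<Sum>i<M. ord_nat r i)"
        by (simp add: prod_dividef power_sum Y_def algebra_simps)
      then show ?case
        using \<rho>(2)[OF elim] by simp
    qed
  qed
  show ?thesis
    unfolding prod_lim_factor[OF r, symmetric]
    using Lim_transform_eventually[OF lim ev] unfolding prod_eq Y_def .
qed

section \<open>The pencil \<open>A + t B\<close> and its blow-ups\<close>

definition pencil :: "real \<Rightarrow> complex poly poly" where
  "pencil t = smult [:(1 - \<i> * t) / 2:] P + smult [:(1 + \<i> * t) / 2:] (pbar P)"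

lemma eval2_pencil:
  "eval2 (pencil t) x y = (eval2 P x y + eval2 (pbar P) x y) / 2
     + of_real t * ((eval2 P x y - eval2 (pbar P) x y) / (2 * \<i>))"
  by (simp add: pencil_def eval2_add eval2_smult divide_i field_simps)

lemma eval2_pencil_cnj: "eval2 (pencil t) (cnj x) (cnj y) = cnj (eval2 (pencil t) x y)"
  by (simp add: pencil_def eval2_add eval2_smult eval2_pbar)

lemma poly_qc_cnj: "poly (qc r) (cnj x) = cnj (poly (qc r) x)"
  by (rule poly_cnj_real[symmetric]) (simp add: coeff_map_poly)

definition blowup :: "real \<Rightarrow> nat \<Rightarrow> complex poly poly" where
  "blowup t r = pcompose (pencil t) [:- qc r, monom 1 (2 * L r):]"

lemma eval2_blowup: "eval2 (blowup t r) x w = eval2 (pencil t) x (- poly (qc r) x + w * x ^ (2 * L r))"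
  by (simp add: blowup_def eval2_pcompose poly_monom)

text \<open>For real \<open>x\<close>, conjugating the quotient of \<open>P\<close> at
  \<open>cnj w\<close> gives the quotient of \<open>pbar P\<close> at \<open>w\<close>. As
  \<open>deeper_poly r\<close> is real, it factors out of the combined limit.\<close>

lemma tendsto_blowup:
  assumes r: "r < M"
  shows "((\<lambda>x::real. eval2 (blowup t r) (of_real x) w / of_real x ^ (\<Sum>i<M. ord_nat r i))
          \<longlongrightarrow> poly (deeper_poly r * hb_poly t (lead r) (same_poly r)) w) (at_right 0)"
proof -
  define N where "N = (\<Sum>i<M. ord_nat r i)"
  define G where "G = (\<lambda>x w. eval2 P (of_real x) (- poly (qc r) (of_real x) + w * of_real x ^ (2 * L r)) / of_real x ^ N)"
  have G: "((\<lambda>x. G x w) \<longlongrightarrow> lead r * poly (same_poly r) w * poly (deeper_poly r) w) (at_right 0)" for w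
    unfolding G_def N_def using tendsto_P_blowup[OF r] .
  have "((\<lambda>x::real. (1 - \<i> * t) / 2 * G x w + (1 + \<i> * t) / 2 * cnj (G x (cnj w)))
     \<longlongrightarrow> (1 - \<i> * t) / 2 * (lead r * poly (same_poly r) w * poly (deeper_poly r) w)
       + (1 + \<i> * t) / 2 * cnj (lead r * poly (same_poly r) (cnj w) * poly (deeper_poly r) (cnj w))) (at_right 0)"
    by (intro tendsto_intros G tendsto_cnj)
  moreover have "cnj (poly (deeper_poly r) (cnj w)) = poly (deeper_poly r) w"
    by (simp add: deeper_poly_def poly_prod)
  moreover have "(1 - \<i> * t) / 2 * G x w + (1 + \<i> * t) / 2 * cnj (G x (cnj w))
      = eval2 (blowup t r) (of_real x) w / of_real x ^ N" for x
    using poly_qc_cnj[of r "of_real x"]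
    by (simp add: eval2_blowup pencil_def eval2_add eval2_smult eval2_pbar G_def add_divide_distrib)
  ultimately show ?thesis
    by (simp add: N_def hb_poly_def poly_map_poly_cnj algebra_simps)
qed

lemma real_root_series:
  assumes r: "r < M"
    and root: "poly (hb_poly t (lead r) (same_poly r)) (of_real s) = 0"
      "poly (pderiv (hb_poly t (lead r) (same_poly r))) (of_real s) \<noteq> 0"
      "poly (deeper_poly r) (of_real s) \<noteq> 0"
  shows "\<exists>f. fps_conv_radius f > 0 \<and> fps_nth f 0 = s
           \<and> poly (map_poly fps_of_poly (pencil t)) (- fps_of_poly (qc r) + fps_X ^ (2 * L r) * cfps f) = 0"
proof -
  define N where "N = (\<Sum>i<M. ord_nat r i)"
  obtain Q where Q: "blowup t r = smult (monom 1 N) Q"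
    "\<And>w. eval2 Q 0 w = poly (deeper_poly r * hb_poly t (lead r) (same_poly r)) w"
    using eval2_divide_power_x[OF tendsto_blowup[OF r]] unfolding N_def by blast
  \<comment> \<open>The pencil, \<open>qc r\<close> and \<open>monom 1 N\<close> commute with
    conjugation; cancelling the monomial shows that \<open>Q\<close> is real, which yields real
    branches.\<close>
  have "eval2 (smult (monom 1 N) (pbar Q)) x y = eval2 (smult (monom 1 N) Q) x y" for x y
  proof -
    have "eval2 (smult (monom 1 N) (pbar Q)) x y = cnj (eval2 (smult (monom 1 N) Q) (cnj x) (cnj y))"
      by (simp add: eval2_smult eval2_pbar poly_monom)
    also have "\<dots> = cnj (eval2 (blowup t r) (cnj x) (cnj y))"
      by (simp only: Q(1))
    also have "\<dots> = eval2 (blowup t r) x y"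
      using eval2_pencil_cnj[of t x "- poly (qc r) x + y * x ^ (2 * L r)"]
      by (simp add: eval2_blowup poly_qc_cnj)
    finally show ?thesis by (simp only: Q(1))
  qed
  then have "smult (monom 1 N) (pbar Q) = smult (monom 1 N) Q"
    by (rule eval2_eqI)
  then have "monom 1 N * coeff (pbar Q) n = monom 1 N * coeff Q n" for n
    by (metis coeff_smult)
  then have real: "pbar Q = Q"
    by (intro poly_eqI) simp
  have "poly (at_x0 Q) = poly (deeper_poly r * hb_poly t (lead r) (same_poly r))"
    using Q(2) by (simp add: eval2_at_0 fun_eq_iff)
  then have at0: "at_x0 Q = deeper_poly r * hb_poly t (lead r) (same_poly r)"
    by (simp only: poly_eq_poly_eq_iff)
  \<comment> \<open>At a zero of the Hermite--Biehler factor the product rule leaves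
    \<open>deeper_poly r\<close> times its derivative, and both are nonzero there.\<close>
  obtain f where f: "fps_conv_radius f > 0" "fps_nth f 0 = s" "poly (map_poly fps_of_poly Q) (cfps f) = 0"
    using implicit_function_real_fps[OF real, of s] root by (auto simp: eval2_at_0 at0 pderiv_mult)
  have "poly (map_poly fps_of_poly (blowup t r)) (cfps f) = 0"
    unfolding Q(1) fps_eval_smult f(3) by simp
  then have "poly (map_poly fps_of_poly (pencil t)) (- fps_of_poly (qc r) + fps_X ^ (2 * L r) * cfps f) = 0"
    by (simp add: blowup_def fps_eval_pcompose fps_of_poly_uminus fps_of_poly_monom' mult.commute)
  with f show ?thesis by blast
qed

text \<open>The first set collects the \<open>t\<close> for which the Hermite--Biehler polynomial
  drops in degree, the second those for which it shares a zero with
  \<open>deeper_poly r\<close>.\<close>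

definition bad :: "real set" where
  "bad = (\<Union>r<M. {t. Re (lead r) + t * Im (lead r) = 0})
     \<union> (\<Union>r<M. \<Union>i\<in>deeper r. {t. poly (hb_poly t (lead r) (same_poly r)) (of_real (coeff (q r - q i) (2 * L r))) = 0})"

text \<open>At a real point the Hermite--Biehler polynomial is \<open>Re z + t * Im z\<close>, where
  \<open>z\<close> is nonzero because \<open>same_poly r\<close> has no real zeros. This affine
  function of \<open>t\<close> has at most one zero.\<close>

lemma finite_bad: "finite bad"
proof -
  have fin: "finite {t. poly (hb_poly t (lead r) (same_poly r)) (of_real s) = 0}" if "r < M" for r s
  proof -
    have "poly (same_poly r) (of_real s) \<noteq> 0"
    proof -
      have "fps_nth (\<psi> i) 0 + of_real s \<noteq> 0" if "i \<in> same r" for i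
        using \<psi>Im[of i] that by (auto simp: same_def complex_eq_iff)
      then show ?thesis by (simp add: same_poly_def poly_prod)
    qed
    then have "lead r * poly (same_poly r) (of_real s) \<noteq> 0"
      using lead_nonzero[OF that] by simp
    from finite_Re_plus_Im_zero[OF this] show ?thesis
      by (simp only: poly_hb_poly_of_real of_real_eq_0_iff)
  qed
  show ?thesis
    unfolding bad_def by (intro finite_UnI finite_UN_I finite_Re_plus_Im_zero lead_nonzero fin) auto
qed

lemma root_values:
  assumes r: "r < M" and t: "t \<notin> bad"
  shows "\<exists>S. finite S \<and> card S = card (same r) \<and> (\<forall>s\<in>S. (\<forall>i\<in>deeper r. s \<noteq> coeff (q r - q i) (2 * L r))
     \<and> (\<exists>f. fps_conv_radius f > 0 \<and> fps_nth f 0 = s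
           \<and> poly (map_poly fps_of_poly (pencil t)) (- fps_of_poly (qc r) + fps_X ^ (2 * L r) * cfps f) = 0))"
proof -
  define h where "h = hb_poly t (lead r) (same_poly r)"
  have "r \<in> same r" using r by (simp add: same_def)
  moreover have "Re (lead r) + t * Im (lead r) \<noteq> 0"
    using t r by (auto simp: bad_def)
  ultimately obtain S where S: "finite S" "card S = card (same r)"
    "\<And>s. s \<in> S \<Longrightarrow> poly h (of_real s) = 0 \<and> poly (pderiv h) (of_real s) \<noteq> 0"
    using hermite_biehler[of "same r" "\<lambda>i. fps_nth (\<psi> i) 0" "lead r" t] \<psi>Im
    unfolding h_def same_poly_def by (auto simp: same_def)
  have ne: "s \<noteq> coeff (q r - q i) (2 * L r)" if "s \<in> S" "i \<in> deeper r" for s i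
    using t r S(3)[OF that(1)] that(2) unfolding h_def bad_def by auto
  have "poly (deeper_poly r) (of_real s) \<noteq> 0" if "s \<in> S" for s
  proof
    assume "poly (deeper_poly r) (of_real s) = 0"
    then obtain i where i: "i \<in> deeper r" "of_real (coeff (q i - q r) (2 * L r)) + complex_of_real s = 0"
      by (auto simp: deeper_poly_def poly_prod)
    then have "s = coeff (q r - q i) (2 * L r)"
      by (simp add: complex_eq_iff)
    with ne[OF that i(1)] show False by simp
  qed
  then show ?thesis
    using S ne real_root_series[OF r] unfolding h_def by (intro exI[of _ S]) auto
qed

text \<open>Within a class of equal data the indices are sent injectively to starting values, of
  which there are as many as indices. The last two properties are what fixes the orders in
  \<open>Ord_branch_difference\<close>.\<close>

lemma choose_roots:
  assumes t: "t \<notin> bad"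
  obtains \<phi> :: "nat \<Rightarrow> real fps" where
    "\<And>j. j < M \<Longrightarrow> fps_conv_radius (\<phi> j) > 0"
    "\<And>j. j < M \<Longrightarrow> poly (map_poly fps_of_poly (pencil t)) (- (fps_of_poly (qc j) + fps_X ^ (2 * L j) * cfps (\<phi> j))) = 0"
    "\<And>i j. j < M \<Longrightarrow> i \<in> deeper j \<Longrightarrow> coeff (q j - q i) (2 * L j) + fps_nth (\<phi> j) 0 \<noteq> 0"
    "\<And>i j. j < M \<Longrightarrow> i \<in> same j \<Longrightarrow> i \<noteq> j \<Longrightarrow> fps_nth (\<phi> i) 0 \<noteq> fps_nth (\<phi> j) 0"
proof -
  define good where "good = (\<lambda>r f. fps_conv_radius f > 0
    \<and> poly (map_poly fps_of_poly (pencil t)) (- fps_of_poly (qc r) + fps_X ^ (2 * L r) * cfps f) = 0)"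
  have "\<forall>r. \<exists>S. r < M \<longrightarrow> finite S \<and> card S = card (same r)
     \<and> (\<forall>s\<in>S. (\<forall>i\<in>deeper r. s \<noteq> coeff (q r - q i) (2 * L r)) \<and> (\<exists>f. good r f \<and> fps_nth f 0 = s))"
  proof
    fix r
    show "\<exists>S. r < M \<longrightarrow> finite S \<and> card S = card (same r)
     \<and> (\<forall>s\<in>S. (\<forall>i\<in>deeper r. s \<noteq> coeff (q r - q i) (2 * L r)) \<and> (\<exists>f. good r f \<and> fps_nth f 0 = s))"
    proof (cases "r < M")
      case True
      from root_values[OF True t] show ?thesis unfolding good_def by (simp add: conj_ac)
    qed simp
  qed
  from choice[OF this] obtain S where S: "\<And>r. r < M \<Longrightarrow> finite (S r)" "\<And>r. r < M \<Longrightarrow> card (S r) = card (same r)"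
    "\<And>r s i. r < M \<Longrightarrow> s \<in> S r \<Longrightarrow> i \<in> deeper r \<Longrightarrow> s \<noteq> coeff (q r - q i) (2 * L r)"
    "\<And>r s. r < M \<Longrightarrow> s \<in> S r \<Longrightarrow> \<exists>f. good r f \<and> fps_nth f 0 = s"
    by blast
  have "\<exists>f. f ` same r \<subseteq> S r \<and> inj_on f (same r)" if "r < M" for r
    using S(1,2)[OF that] by (intro card_le_inj) auto
  then obtain \<eta> where \<eta>: "\<And>r. r < M \<Longrightarrow> \<eta> r ` same r \<subseteq> S r" "\<And>r. r < M \<Longrightarrow> inj_on (\<eta> r) (same r)"
    by metis
  \<comment> \<open>Indices with equal data must share one set of values, so the set is taken at a representative.\<close>
  define rep where "rep = (\<lambda>j. SOME i. i \<in> same j)"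
  have rep: "rep j \<in> same j" if "j < M" for j
    unfolding rep_def by (rule someI[of _ j]) (use that in \<open>simp add: same_def\<close>)
  have rep_less: "rep j < M" and rep_data: "L (rep j) = L j" "q (rep j) = q j" if "j < M" for j
    using rep[OF that] by (auto simp: same_def)
  have rep_eq: "rep i = rep j" if "i \<in> same j" for i j
  proof -
    have "same i = same j" using that by (auto simp: same_def)
    then show ?thesis by (simp add: rep_def)
  qed
  have mem: "j \<in> same (rep j)" if "j < M" for j
    using rep_data[OF that] that by (simp add: same_def)
  define s where "s = (\<lambda>j. \<eta> (rep j) j)"
  have s: "s j \<in> S (rep j)" if "j < M" for j
    using \<eta>(1)[OF rep_less[OF that]] mem[OF that] by (auto simp: s_def)
  have "\<forall>j. \<exists>f. j < M \<longrightarrow> good j f \<and> fps_nth f 0 = s j"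
  proof
    fix j
    show "\<exists>f. j < M \<longrightarrow> good j f \<and> fps_nth f 0 = s j"
    proof (cases "j < M")
      case True
      then have "good (rep j) = good j" by (simp add: good_def rep_data)
      with S(4)[OF rep_less[OF True] s[OF True]] show ?thesis by simp
    qed simp
  qed
  from choice[OF this] obtain f where f: "\<And>j. j < M \<Longrightarrow> good j (f j)" "\<And>j. j < M \<Longrightarrow> fps_nth (f j) 0 = s j"
    by blast
  have cfps_neg: "cfps (- g) = - cfps g" for g
    by (simp add: fps_eq_iff)
  show thesis
  \<comment> \<open>The sign changes because the root is \<open>- q + x^(2L) f\<close>, while the
    factor to be produced is \<open>y + q + x^(2L) \<phi>\<close>.\<close>
  proof (rule that[of "\<lambda>j. - f j"])
    fix j assume j: "j < M"
    show "fps_conv_radius (- f j) > 0" using f(1)[OF j] by (simp add: good_def)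
    show "poly (map_poly fps_of_poly (pencil t)) (- (fps_of_poly (qc j) + fps_X ^ (2 * L j) * cfps (- f j))) = 0"
      using f(1)[OF j] by (simp add: cfps_neg good_def)
    show "coeff (q j - q i) (2 * L j) + fps_nth (- f j) 0 \<noteq> 0" if "i \<in> deeper j" for i
    proof -
      have "deeper (rep j) = deeper j" using rep_data[OF j] by (simp add: deeper_def)
      then have "s j \<noteq> coeff (q j - q i) (2 * L j)"
        using S(3)[OF rep_less[OF j] s[OF j], of i] that rep_data[OF j] by simp
      then show ?thesis using f(2)[OF j] by simp
    qed
    show "fps_nth (- f i) 0 \<noteq> fps_nth (- f j) 0" if "i \<in> same j" "i \<noteq> j" for i
    proof -
      have i: "i < M" using that by (simp add: same_def)
      have "i \<in> same (rep j)"
        using mem[OF i] rep_eq[OF that(1)] by simp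
      then have "s i \<noteq> s j"
        using \<eta>(2)[OF rep_less[OF j]] mem[OF j] that(2) rep_eq[OF that(1)]
        by (auto simp: s_def inj_on_def)
      then show ?thesis using f(2)[OF i] f(2)[OF j] by simp
    qed
  qed
qed

section \<open>Orders of differences of the branches\<close>

lemma mem_sameI:
  assumes "i < M" "j < M" "L i = L j" "\<And>m. m < 2 * L j \<Longrightarrow> coeff (q j - q i) m = 0"
  shows "i \<in> same j"
proof -
  have "coeff (q i) m = coeff (q j) m" for m
    using assms coeff_eq_0[of "q i" m] coeff_eq_0[of "q j" m] qdeg[of i] qdeg[of j]
    by (cases "m < 2 * L j") auto
  then have "q i = q j" by (rule poly_eqI)
  with assms show ?thesis by (simp add: same_def)
qed

text \<open>Below \<open>n\<close> all coefficients vanish. At \<open>n\<close> there are three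
  cases: a coefficient of \<open>q j - q i\<close> alone; for equal data, a difference of distinct
  constant terms; for \<open>n = 2 * L j < 2 * L i\<close>, the sum kept nonzero by avoiding the
  zeros of \<open>deeper_poly j\<close>. The case with \<open>i\<close> and \<open>j\<close>
  exchanged differs in sign only.\<close>

lemma Ord_branch_difference:
  assumes deeper: "\<And>i j. j < M \<Longrightarrow> i \<in> deeper j \<Longrightarrow> coeff (q j - q i) (2 * L j) + fps_nth (\<phi> j) 0 \<noteq> 0"
    and same: "\<And>i j. j < M \<Longrightarrow> i \<in> same j \<Longrightarrow> i \<noteq> j \<Longrightarrow> fps_nth (\<phi> i) 0 \<noteq> fps_nth (\<phi> j) 0"
    and ij: "i < M" "j < M" "i \<noteq> j"
  shows "Ord (fps_of_poly (q j) - fps_of_poly (q i) + fps_X ^ (2 * L j) * \<phi> j - fps_X ^ (2 * L i) * \<phi> i) = Oij q L i j"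
    (is "Ord ?D = _")
proof (rule Oij_cases[of q L i j])
  fix n assume n: "Oij q L i j = enat n" "n \<le> 2 * L j" "n \<le> 2 * L i"
    "\<And>k. k < n \<Longrightarrow> coeff (q j - q i) k = 0" "n = 2 * L j \<or> n = 2 * L i \<or> coeff (q j - q i) n \<noteq> 0"
  have nth: "fps_nth ?D m = coeff (q j - q i) m + (if m < 2 * L j then 0 else fps_nth (\<phi> j) (m - 2 * L j))
      - (if m < 2 * L i then 0 else fps_nth (\<phi> i) (m - 2 * L i))" for m
    by (simp add: fps_X_power_mult_nth)
  have "fps_nth ?D n \<noteq> 0"
  proof (cases "L i" "L j" rule: linorder_cases)
    case equal
    show ?thesis
    proof (cases "n = 2 * L j")
      case True
      then have "i \<in> same j" using n(4) ij equal by (intro mem_sameI) auto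
      then show ?thesis
        unfolding nth using same[OF ij(2) \<open>i \<in> same j\<close> ij(3)] True equal by (simp add: same_def)
    next
      case False
      then show ?thesis unfolding nth using n equal by auto
    qed
  next
    case greater
    show ?thesis
    proof (cases "n = 2 * L j")
      case True
      have "i \<in> deeper j"
        using n(4) True greater ij by (auto simp: deeper_def)
      from deeper[OF ij(2) this] show ?thesis
        unfolding nth using True greater by simp
    next
      case False
      then show ?thesis unfolding nth using n greater by auto
    qed
  next
    case less
    show ?thesis
    proof (cases "n = 2 * L i")
      case True
      have "j \<in> deeper i"
        using n(4) True less ij by (auto simp: deeper_def)
      from deeper[OF ij(1) this] show ?thesis
        unfolding nth using True less by simp
    next
      case False
      then show ?thesis unfolding nth using n less by auto
    qed
  qed
  moreover have "fps_nth ?D m = 0" if "m < n" for m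
    unfolding nth using n that by auto
  ultimately show ?thesis
    using n(1) by (simp add: Ord_eqI)
qed

text \<open>The \<open>M\<close> distinct roots are split off over the convergent power series. At
  \<open>x = 0\<close> every linear factor becomes \<open>y\<close>, so the constant term of the
  cofactor is the coefficient of \<open>y^M\<close> in the pencil.\<close>

lemma local_factorization:
  assumes conv: "\<And>j. j < M \<Longrightarrow> fps_conv_radius (\<phi> j) > 0"
    and root: "\<And>j. j < M \<Longrightarrow> poly (map_poly fps_of_poly (pencil t)) (- (fps_of_poly (qc j) + fps_X ^ (2 * L j) * cfps (\<phi> j))) = 0"
    and inj: "inj_on (\<lambda>j. fps_of_poly (qc j) + fps_X ^ (2 * L j) * cfps (\<phi> j)) {..<M}"
  shows "\<exists>v. unit_ps2 v \<and> (\<exists>r>0. \<forall>x y. norm x < r \<longrightarrow> norm y < r \<longrightarrow>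
      eval2 (pencil t) x y = eval_ps2 v x y * (\<Prod>j<M. y + poly (qc j) x + x ^ (2 * L j) * eval_fps (cfps (\<phi> j)) x))"
proof -
  define b where "b = (\<lambda>j. - (fps_of_poly (qc j) + fps_X ^ (2 * L j) * cfps (\<phi> j)))"
  \<comment> \<open>The element 1 keeps the set nonempty when \<open>M = 0\<close>.\<close>
  define \<rho> where "\<rho> = Min (insert 1 ((\<lambda>j. fps_conv_radius (\<phi> j)) ` {..<M}))"
  have \<rho>: "\<rho> > 0" "\<And>j. j < M \<Longrightarrow> \<rho> \<le> fps_conv_radius (\<phi> j)"
    unfolding \<rho>_def using conv by (auto intro: Min_le)
  have X: "fps_conv_radius (fps_X ^ n :: complex fps) = \<infinity>" for n
    unfolding fps_of_poly_monom'[symmetric] by (rule fps_conv_radius_fps_of_poly)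
  have conv_b: "fps_conv_radius (b j) \<ge> \<rho>" if "j < M" for j
    unfolding b_def using \<rho>(2)[OF that]
    by (simp only: fps_conv_radius_uminus) (intro fps_conv_radius_add_ge fps_conv_radius_mult_ge; simp add: X)
  have eval_b: "eval_fps (b j) x = - (poly (qc j) x + x ^ (2 * L j) * eval_fps (cfps (\<phi> j)) x)"
    if "j < M" "ereal (norm x) < \<rho>" for j x
  proof -
    have x: "ereal (norm x) < fps_conv_radius (\<phi> j)"
      using that \<rho>(2) by (blast intro: less_le_trans)
    moreover have "fps_conv_radius (fps_X ^ (2 * L j) * cfps (\<phi> j)) \<ge> fps_conv_radius (\<phi> j)"
      by (intro fps_conv_radius_mult_ge) (auto simp: X)
    ultimately have x': "ereal (norm x) < fps_conv_radius (fps_X ^ (2 * L j) * cfps (\<phi> j))"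
      by (rule less_le_trans)
    have "eval_fps (fps_of_poly (qc j) + fps_X ^ (2 * L j) * cfps (\<phi> j)) x
        = poly (qc j) x + eval_fps (fps_X ^ (2 * L j)) x * eval_fps (cfps (\<phi> j)) x"
      using x x' by (simp add: eval_fps_add eval_fps_mult X)
    moreover have "eval_fps (fps_X ^ (2 * L j)) x = x ^ (2 * L j)"
      unfolding fps_of_poly_monom'[symmetric] by (simp add: poly_monom)
    moreover have "ereal (norm x) < fps_conv_radius (fps_of_poly (qc j) + fps_X ^ (2 * L j) * cfps (\<phi> j))"
      using x' fps_conv_radius_add[of "fps_of_poly (qc j)" "fps_X ^ (2 * L j) * cfps (\<phi> j)"] by simp
    ultimately show ?thesis
      unfolding b_def by (simp only: eval_fps_minus)
  qed
  obtain V where V: "coeffs_conv \<rho> V"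
    "\<And>x y. ereal (norm x) < \<rho> \<Longrightarrow> evalf (map_poly fps_of_poly (pencil t)) x y = evalf V x y * (\<Prod>j<M. y - eval_fps (b j) x)"
  proof -
    have "inj_on b {..<M}"
      unfolding inj_on_def b_def neg_equal_iff_equal using inj by (simp add: inj_on_def)
    moreover have "poly (map_poly fps_of_poly (pencil t)) (b j) = 0" "fps_conv_radius (b j) \<ge> \<rho>" if "j \<in> {..<M}" for j
      using root[of j] conv_b[of j] that by (simp_all only: b_def lessThan_iff)
    moreover have "coeffs_conv \<rho> (map_poly fps_of_poly (pencil t))"
      by (simp add: coeffs_conv_def coeff_map_poly)
    ultimately have "\<exists>V. coeffs_conv \<rho> V \<and> map_poly fps_of_poly (pencil t) = V * (\<Prod>j<M. [:- b j, 1:])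
           \<and> (\<forall>x y. ereal (norm x) < \<rho> \<longrightarrow>
                evalf (map_poly fps_of_poly (pencil t)) x y = evalf V x y * (\<Prod>j<M. y - eval_fps (b j) x))"
      by (rule evalf_factor_distinct_roots[OF finite_lessThan])
    then show thesis using that by (elim exE conjE) simp
  qed
  have eval_F: "eval2 (pencil t) x y = evalf V x y * (\<Prod>j<M. y + poly (qc j) x + x ^ (2 * L j) * eval_fps (cfps (\<phi> j)) x)"
    if "ereal (norm x) < \<rho>" for x y
  proof -
    have "(\<Prod>j<M. y - eval_fps (b j) x) = (\<Prod>j<M. y + poly (qc j) x + x ^ (2 * L j) * eval_fps (cfps (\<phi> j)) x)"
      using eval_b that by (intro prod.cong) (auto simp: add.assoc)
    then show ?thesis using V(2)[OF that, of y] by (simp add: evalf_map_poly_fps_of_poly)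
  qed
  define v where "v = (\<lambda>m n. fps_nth (coeff V n) m)"
  have "v 0 0 \<noteq> 0"
  proof -
    define V0 where "V0 = map_poly (\<lambda>f. fps_nth f 0) V"
    have "poly (at_x0 (pencil t)) y = poly (monom 1 M * V0) y" for y
    proof -
      have "y + poly (qc j) 0 + 0 ^ (2 * L j) * eval_fps (cfps (\<phi> j)) 0 = y" if "j < M" for j
        using q0[OF that] qdeg[OF that] by (simp add: poly_0_coeff_0 coeff_map_poly)
      then have "(\<Prod>j<M. y + poly (qc j) 0 + 0 ^ (2 * L j) * eval_fps (cfps (\<phi> j)) 0) = (\<Prod>j<M. y)"
        by (intro prod.cong) auto
      then have "eval2 (pencil t) 0 y = evalf V 0 y * y ^ M"
        using eval_F[of 0 y] \<rho>(1) by (simp add: zero_ereal_def)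
      then show ?thesis
        by (simp add: eval2_at_0 evalf_def eval_fps_at_0 V0_def poly_monom mult.commute)
    qed
    then have "at_x0 (pencil t) = monom 1 M * V0"
      by (intro poly_eq_poly_eq_iff[THEN iffD1] ext)
    then have "coeff (at_x0 (pencil t)) M = v 0 0"
      by (simp add: coeff_monom_mult V0_def coeff_map_poly v_def)
    \<comment> \<open>The coefficient is real, so both terms of the pencil carry it, and their
      weights \<open>(1 - i t) / 2\<close> and \<open>(1 + i t) / 2\<close> add up to 1.\<close>
    moreover have "coeff (at_x0 (pencil t)) M = coeff (at_x0 P) M"
    proof -
      have "cnj (coeff (at_x0 P) M) = coeff (at_x0 P) M"
        using coeff_at_x0(2) by (simp add: Reals_cnj_iff)
      moreover have "coeff (at_x0 (pencil t)) M = (1 - \<i> * t) / 2 * coeff (at_x0 P) M + (1 + \<i> * t) / 2 * cnj (coeff (at_x0 P) M)"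
        by (simp add: at_x0_def pencil_def pbar_def coeff_map_poly poly_0_coeff_0)
      ultimately show ?thesis by (simp add: algebra_simps flip: add_divide_distrib)
    qed
    ultimately show ?thesis using coeff_at_x0(1) by simp
  qed
  then have v: "unit_ps2 v"
    unfolding unit_ps2_def v_def using conv_ps2_coeffs[OF V(1) \<rho>(1)] by simp
  obtain r :: real where r: "r > 0" "ereal r < \<rho>"
    using ereal_dense2[OF \<rho>(1)] by auto
  have "eval2 (pencil t) x y = eval_ps2 v x y * (\<Prod>j<M. y + poly (qc j) x + x ^ (2 * L j) * eval_fps (cfps (\<phi> j)) x)"
    if "norm x < r" for x y
  proof -
    have x: "ereal (norm x) < \<rho>"
      using that r(2) by (intro less_trans[OF _ r(2)]) simp
    show ?thesis
      using eval_F[OF x, of y] eval_ps2_coeffs[OF V(1) x, of y] by (simp add: v_def)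
  qed
  with v r(1) show ?thesis by (intro exI[of _ v] conjI exI[of _ r]) auto
qed

text \<open>Equal branches would have difference 0, of infinite order, whereas \<open>Oij\<close> is
  always finite.\<close>

lemma inj_branches:
  assumes "\<And>i j. i < M \<Longrightarrow> j < M \<Longrightarrow> i \<noteq> j \<Longrightarrow>
    Ord (fps_of_poly (q j) - fps_of_poly (q i) + fps_X ^ (2 * L j) * \<phi> j - fps_X ^ (2 * L i) * \<phi> i) = Oij q L i j"
  shows "inj_on (\<lambda>j. fps_of_poly (qc j) + fps_X ^ (2 * L j) * cfps (\<phi> j)) {..<M}"
proof (rule inj_onI, rule ccontr)
  fix i j assume ij: "i \<in> {..<M}" "j \<in> {..<M}" "i \<noteq> j"
    and eq: "fps_of_poly (qc i) + fps_X ^ (2 * L i) * cfps (\<phi> i) = fps_of_poly (qc j) + fps_X ^ (2 * L j) * cfps (\<phi> j)"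
  have nth: "fps_nth (fps_of_poly (qc l) + fps_X ^ (2 * L l) * cfps (\<phi> l)) m
      = of_real (fps_nth (fps_of_poly (q l) + fps_X ^ (2 * L l) * \<phi> l) m)" for l m
    by (simp add: fps_X_power_mult_nth coeff_map_poly)
  have "fps_nth (fps_of_poly (q i) + fps_X ^ (2 * L i) * \<phi> i) m
     = fps_nth (fps_of_poly (q j) + fps_X ^ (2 * L j) * \<phi> j) m" for m
    using nth[of i m] nth[of j m] eq by (metis of_real_eq_iff)
  then have "fps_of_poly (q i) + fps_X ^ (2 * L i) * \<phi> i = fps_of_poly (q j) + fps_X ^ (2 * L j) * \<phi> j"
    by (simp add: fps_eq_iff)
  then have "fps_of_poly (q j) - fps_of_poly (q i) + fps_X ^ (2 * L j) * \<phi> j - fps_X ^ (2 * L i) * \<phi> i = 0"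
    by (simp add: algebra_simps)
  with assms[of i j] ij have "Oij q L i j = \<infinity>"
    by (simp add: Ord_def)
  then show False
    using Oij_cases[of q L i j False] by simp
qed

end

theorem theorem3p5:
  fixes P :: "complex poly poly"
    and k :: nat and L :: "nat \<Rightarrow> nat" and q :: "nat \<Rightarrow> real poly"
    and \<psi> :: "nat \<Rightarrow> complex fps" and u :: "nat \<Rightarrow> nat \<Rightarrow> complex"
  defines "M \<equiv> order 0 (at_x0 P)"
  assumes nozeros: "\<And>x y. x \<in> \<real> \<Longrightarrow> Im y > 0 \<Longrightarrow> eval2 P x y \<noteq> 0"
    and coprime: "coprime P (pbar P)"
    and normalized: "coeff (at_x0 P) M \<in> \<real>"
    and k: "k \<ge> 1"
    and u: "unit_ps2 u"
    and q0: "\<And>j. j < M \<Longrightarrow> poly (q j) 0 = 0"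
    and qdeg: "\<And>j. j < M \<Longrightarrow> degree (q j) < 2 * L j"
    and \<psi>conv: "\<And>j. j < M \<Longrightarrow> fps_conv_radius (\<psi> j) > 0"
    and \<psi>Im: "\<And>j. j < M \<Longrightarrow> Im (fps_nth (\<psi> j) 0) > 0"
    and factorization: "\<exists>r>0. \<forall>x y. norm x < r \<longrightarrow> norm y < r \<longrightarrow>
        eval2 P x y = eval_ps2 u x y *
          (\<Prod>j<M. y + poly (map_poly complex_of_real (q j)) x
                    + x ^ (2 * L j) * eval_fps (\<psi> j) (x powr (1 / of_nat k)))"
  shows "finite {t::real. \<not> (\<exists>v \<phi>. unit_ps2 v
            \<and> (\<forall>j<M. fps_conv_radius (\<phi> j :: real fps) > 0)
            \<and> (\<exists>r>0. \<forall>x y. norm x < r \<longrightarrow> norm y < r \<longrightarrow>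
                 (eval2 P x y + eval2 (pbar P) x y) / 2
                   + of_real t * ((eval2 P x y - eval2 (pbar P) x y) / (2 * \<i>))
                 = eval_ps2 v x y *
                   (\<Prod>j<M. y + poly (map_poly complex_of_real (q j)) x
                             + x ^ (2 * L j) * eval_fps (cfps (\<phi> j)) x))
            \<and> (\<forall>i<M. \<forall>j<M. i \<noteq> j \<longrightarrow>
                 Ord (fps_of_poly (q j) - fps_of_poly (q i)
                      + fps_X ^ (2 * L j) * \<phi> j - fps_X ^ (2 * L i) * \<phi> i)
                 = Oij q L i j))}"
proof -
  \<comment> \<open>One point of the upper half plane shows that \<open>P(0, y)\<close> is not the
    zero polynomial, so its coefficient at the vanishing order \<open>M\<close> is nonzero.\<close>
  have "eval2 P 0 \<i> \<noteq> 0"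
    using nozeros[of 0 \<i>] by simp
  then have nz: "at_x0 P \<noteq> 0"
    by (auto simp: eval2_at_0)
  have "monom 1 M dvd at_x0 P" "\<not> monom 1 (Suc M) dvd at_x0 P"
    using nz by (simp_all add: monom_1_dvd_iff M_def)
  then have top: "coeff (at_x0 P) M \<noteq> 0"
    unfolding monom_1_dvd_iff' by (auto simp: less_Suc_eq)
  interpret stable_factorization P k L q \<psi> u M
    by unfold_locales (use top normalized k u q0 qdeg \<psi>conv \<psi>Im factorization in auto)
  show ?thesis
  proof (rule finite_subset[OF _ finite_bad], rule subsetI, rule ccontr, unfold mem_Collect_eq, erule notE)
    fix t assume "t \<notin> bad"
    then obtain \<phi> where \<phi>: "\<And>j. j < M \<Longrightarrow> fps_conv_radius (\<phi> j) > 0"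
      "\<And>j. j < M \<Longrightarrow> poly (map_poly fps_of_poly (pencil t)) (- (fps_of_poly (qc j) + fps_X ^ (2 * L j) * cfps (\<phi> j))) = 0"
      "\<And>i j. j < M \<Longrightarrow> i \<in> deeper j \<Longrightarrow> coeff (q j - q i) (2 * L j) + fps_nth (\<phi> j) 0 \<noteq> 0"
      "\<And>i j. j < M \<Longrightarrow> i \<in> same j \<Longrightarrow> i \<noteq> j \<Longrightarrow> fps_nth (\<phi> i) 0 \<noteq> fps_nth (\<phi> j) 0"
      by (rule choose_roots) blast
    note Ord = Ord_branch_difference[OF \<phi>(3,4)]
    obtain v where "unit_ps2 v" "\<exists>r>0. \<forall>x y. norm x < r \<longrightarrow> norm y < r \<longrightarrow>
      eval2 (pencil t) x y = eval_ps2 v x y * (\<Prod>j<M. y + poly (qc j) x + x ^ (2 * L j) * eval_fps (cfps (\<phi> j)) x)"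
      using local_factorization[OF \<phi>(1,2) inj_branches[OF Ord]] by blast
    then show "\<exists>v \<phi>. unit_ps2 v
            \<and> (\<forall>j<M. fps_conv_radius (\<phi> j :: real fps) > 0)
            \<and> (\<exists>r>0. \<forall>x y. norm x < r \<longrightarrow> norm y < r \<longrightarrow>
                 (eval2 P x y + eval2 (pbar P) x y) / 2
                   + of_real t * ((eval2 P x y - eval2 (pbar P) x y) / (2 * \<i>))
                 = eval_ps2 v x y *
                   (\<Prod>j<M. y + poly (map_poly complex_of_real (q j)) x
                             + x ^ (2 * L j) * eval_fps (cfps (\<phi> j)) x))
            \<and> (\<forall>i<M. \<forall>j<M. i \<noteq> j \<longrightarrow>
                 Ord (fps_of_poly (q j) - fps_of_poly (q i)
                      + fps_X ^ (2 * L j) * \<phi> j - fps_X ^ (2 * L i) * \<phi> i)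
                 = Oij q L i j)"
      unfolding eval2_pencil using \<phi>(1) Ord by (intro exI[of _ v] exI[of _ \<phi>] conjI) auto
  qed
qed

end
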